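(* Let $\ell, p, q$ be primes with $\ell \geq 19$ and $p \equiv q \equiv 1 \pmod{\ell}$. Then the equation \[ \frac{x^\ell - 1}{x - 1} = p^m q \] has at most four solutions $(x, m)$ in positive integers with $x \neq 1$. Moreover, if this equation has five integral solutions $(x_i, m_i)$, $i = 1, \dots, 5$, with $m_5 > m_4 > \cdots > m_1 \geq 0$, then $m_1 = 0$ and $x_2 = x_1^r$ for some integer $r \geq 1$.
   Context: Solutions are pairs of integers $(x, m)$ with $x > 1$ and $m \geq 0$ satisfying the displayed equation. Note that $\frac{x^\ell - 1}{x - 1} = \Phi_\ell(x)$, the $\ell$-th cyclotomic polynomial evaluated at $x$. *)

theory Defs
  imports Complex_Main "HOL-Number_Theory.Cong" "HOL-Computational_Algebra.Primes"
begin

text \<open>The quotient is formed in the rationals, so that no exactness of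
  integer division is presupposed.\<close>

definition is_solution :: "nat \<Rightarrow> nat \<Rightarrow> nat \<Rightarrow> int \<Rightarrow> nat \<Rightarrow> bool" where
  "is_solution l p q x m \<longleftrightarrow>
     x > 1 \<and> (rat_of_int x ^ l - 1) / (rat_of_int x - 1) = rat_of_nat p ^ m * rat_of_nat q"

end

theory Submission
  imports Defs "HOL-Number_Theory.Residue_Primitive_Roots" "HOL-Computational_Algebra.Polynomial"
begin

text \<open>
  All solutions are primitive \<open>l\<close>-th roots of unity modulo powers of \<open>p\<close> (and modulo \<open>q\<close>), so of
  two solutions \<open>x < y\<close> the larger is congruent to a power of the smaller.  By the pigeonhole
  principle two monomials in \<open>x\<close> and \<open>y\<close> of small degree are congruent; unless \<open>x\<close> and \<open>y\<close> are
  multiplicatively dependent, which forces \<open>y = x ^ r\<close>, the modulus is bounded by a small power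
  of \<open>y\<close>.  For five solutions these gaps accumulate to \<open>x\<^sub>4 > x\<^sub>1 ^ 5.8\<close>, so that \<open>q\<close> is negligible
  in \<open>p ^ m\<^sub>4 * q\<close>, and to \<open>x\<^sub>5 > x\<^sub>4 ^ 5.7\<close>.  On the other hand \<open>x\<^sub>5\<close> agrees \<open>p\<close>-adically
  to high precision with a root of unity \<open>x\<^sub>4 ^ k * (1 + \<epsilon>) ^ (- k / l)\<close>, where
  \<open>\<epsilon> = x\<^sub>4 ^ l - 1\<close> is \<open>p\<close>-adically small and \<open>\<bar>k\<bar> < l / 2\<close>, and the diagonal Pade approximations
  of the binomial function are too good to allow this.
\<close>

subsection \<open>Repunits\<close>

text \<open>The obstacle is \<open>q\<close>: it divides every value, but its size is unknown, so a
  congruence modulo \<open>p ^ m i\<close> loses a factor \<open>q\<close>. For the first pair the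
  larger of \<open>p ^ m 1\<close> and \<open>q\<close> serves as the modulus, which is at least the
  square root of the first value. Since \<open>q\<close> is at most that value, its weight falls as
  the solutions grow, but only after three gaps is it small enough; hence five solutions. Only the
  first pair can involve \<open>m 1 = 0\<close>, where \<open>p\<close> need not divide the smaller
  value. In all other cases lifting the exponent excludes \<open>y = x ^ r\<close>. The Pade step is
  a Thue-Siegel argument: an integer divisible by a high power of \<open>p\<close> is compared with
  its real size. Clearing denominators introduces \<open>fact n\<close>, whose growth would ruin the
  comparison; it is won back because the part of \<open>fact n\<close> prime to \<open>l\<close>
  divides the integer too. That the integer is nonzero needs no second approximation: all
  coefficients are positive, so the quotient of numerator and denominator stays between powers with
  exponent \<open>n\<close>, and \<open>x\<^sub>5\<close> is too large for equality.\<close>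

definition repunit :: "nat \<Rightarrow> nat \<Rightarrow> nat" where
  "repunit l x = (\<Sum>i<l. x ^ i)"

lemma repunit_Suc: "repunit (Suc l) x = repunit l x + x ^ l"
  by (simp add: repunit_def)

lemma repunit_geometric: "x \<ge> 1 \<Longrightarrow> (x - 1) * repunit l x + 1 = x ^ l"
proof (induction l)
  case (Suc l)
  then obtain y where y: "x = Suc y" by (cases x) auto
  with Suc show ?case by (simp add: repunit_Suc algebra_simps)
qed (simp add: repunit_def)

lemma repunit_pos: "l > 0 \<Longrightarrow> repunit l x > 0"
  by (cases l) (auto simp: repunit_def sum.lessThan_Suc_shift)

lemma repunit_gt: "x \<ge> 1 \<Longrightarrow> l \<ge> 2 \<Longrightarrow> x ^ (l - 1) < repunit l x"
proof -
  assume "x \<ge> 1" "l \<ge> 2"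
  then obtain k where "l = Suc k" "k > 0" by (cases l) auto
  with repunit_pos[of k x] show ?thesis by (simp add: repunit_Suc)
qed

lemma repunit_less: 
  assumes "x \<ge> 2" shows "repunit (Suc l) x < 2 * x ^ l"
proof (induction l)
  case (Suc l)
  have "2 * x ^ l \<le> x * x ^ l" using assms by (intro mult_right_mono) auto
  thus ?case using Suc unfolding repunit_Suc[of "Suc l"] power_Suc by linarith
qed (simp add: repunit_def)

lemma repunit_mono: "x \<le> y \<Longrightarrow> repunit l x \<le> repunit l y"
  by (simp add: repunit_def sum_mono power_mono)

lemma cong_1_of_dvd_repunit:
  assumes "x \<ge> 1" "N dvd repunit l x"
  shows "[x ^ l = 1] (mod N)"
proof -
  have "[(x - 1) * repunit l x + 1 = 0 + 1] (mod N)"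
    using assms(2) by (intro cong_add) (auto simp: cong_0_iff)
  thus ?thesis using repunit_geometric[OF assms(1)] by simp
qed

lemma repunit_cong: "[x = y] (mod N) \<Longrightarrow> [repunit l x = repunit l y] (mod N)"
  unfolding repunit_def by (intro cong_sum cong_pow)

lemma repunit_1 [simp]: "repunit l 1 = l" "repunit l (Suc 0) = l"
  by (simp_all add: repunit_def)

text \<open>At \<open>x = 1\<close> the repunit is \<open>l\<close>, so \<open>r\<close> would
  divide \<open>l\<close> and hence equal it, against \<open>r = 1\<close> modulo \<open>l\<close>.
  Solutions are thus nontrivial roots of unity already modulo \<open>r\<close>, not only modulo its
  powers.\<close>

lemma not_cong_1_of_dvd_repunit:
  assumes "prime r" "prime l" "[r = 1] (mod l)" "r dvd repunit l x"
  shows "\<not> [x = 1] (mod r)"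
proof
  assume "[x = 1] (mod r)"
  from repunit_cong[OF this, of l] have "[repunit l x = l] (mod r)" by simp
  with assms(4) have "r dvd l" using cong_dvd_iff by blast
  with assms have "r = l" using primes_dvd_imp_eq by blast
  with assms have "[l = 1] (mod l)" by simp
  thus False using assms(2) by (metis cong_0_1_nat cong_dvd_iff dvd_refl nat_dvd_1_iff_1 not_prime_1)
qed

text \<open>The residue group is cyclic of an order divisible by \<open>l\<close>, so both sides are powers of
  a generator with exponents that are multiples of \<open>totient (r ^ e) div l\<close>.\<close>
lemma root_of_unity_eq_power:
  assumes r: "prime r" and l: "prime l" and rl: "[r = 1] (mod l)" and l3: "l \<ge> 3"
    and e: "e \<ge> 1" and x: "x \<ge> 1" "r ^ e dvd repunit l x" and u: "[u ^ l = 1] (mod r ^ e)"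
  shows "\<exists>k<l. [u = x ^ k] (mod r ^ e)"
proof -
  define M where "M = r ^ e"
  have r2: "r > 2"
  proof (rule ccontr)
    assume "\<not> r > 2"
    with r have "r = 2" using prime_ge_2_nat[of r] by linarith
    with rl l3 show False by (simp add: cong_def)
  qed
  hence "odd r" using r prime_odd_nat by blast
  obtain g where "\<forall>k>0. residue_primroot (r ^ k) g"
    using residue_primroot_odd_prime_power_exists[OF r \<open>odd r\<close>] by blast
  hence g: "residue_primroot M g" unfolding M_def using e by auto
  have M1: "M > 1" unfolding M_def using e r2 by (metis One_nat_def Suc_le_eq one_less_power not_numeral_less_one less_trans one_less_numeral_iff semiring_norm(76))
  have bij: "bij_betw (\<lambda>i. g ^ i mod M) {..<totient M} (totatives M)"
    using residue_primroot_is_generator[OF M1 g] .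
  have rd: "r dvd repunit l x" using x(2) e dvd_trans[OF le_imp_power_dvd[OF e, of r]] by simp
  have nx: "\<not> [x = 1] (mod M)"
    using not_cong_1_of_dvd_repunit[OF r l rl rd] e unfolding M_def
    by (metis cong_dvd_modulus_nat dvd_power less_eq_Suc_le One_nat_def)
  have gen: "\<exists>i. [w = g ^ i] (mod M)" if w: "[w ^ l = 1] (mod M)" for w
  proof -
    have "coprime (w ^ l) M" using w by (metis cong_imp_coprime cong_sym coprime_1_left)
    hence "coprime w M" using l3 by (simp add: coprime_power_left_iff)
    hence "w mod M \<in> totatives M" using M1
      by (auto simp: totatives_def intro!: Nat.gr0I)
    then obtain i where "w mod M = g ^ i mod M" using bij unfolding bij_betw_def by blast
    thus ?thesis by (auto simp: cong_def)
  qed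
  have xl: "[x ^ l = 1] (mod M)" using cong_1_of_dvd_repunit x unfolding M_def by blast
  obtain a where a: "[x = g ^ a] (mod M)" using gen[OF xl] by blast
  obtain b where b: "[u = g ^ b] (mod M)" using gen u unfolding M_def by blast
  have og: "ord M g = totient M" using g by (simp add: residue_primroot_def)
  have ga: "totient M dvd a * l"
    using a xl og ord_divides[of g "a * l" M] by (metis cong_pow cong_sym cong_trans power_mult)
  have gb: "totient M dvd b * l"
    using b u og ord_divides[of g "b * l" M] unfolding M_def[symmetric] by (metis cong_pow cong_sym cong_trans power_mult)
  have "totient M = r ^ (e - 1) * (r - 1)"
    unfolding M_def using e r by (simp add: totient_prime_power)
  moreover have "l dvd r - 1" using rl r2 by (simp add: cong_altdef_nat)
  ultimately obtain s where s: "totient M = l * s" by (metis dvd_def dvd_mult)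
  have l0: "l > 0" using l3 by simp
  from ga s l0 have "s dvd a" by (simp add: mult.commute)
  then obtain a' where a': "a = s * a'" by blast
  from gb s l0 have "s dvd b" by (simp add: mult.commute)
  then obtain b' where b': "b = s * b'" by blast
  \<comment> \<open>Here the nontriviality of \<open>x\<close> enters: \<open>a'\<close> becomes
    invertible modulo \<open>l\<close>, so that \<open>x\<close> generates all \<open>l\<close>-th
    roots of unity.\<close>
  have "\<not> l dvd a'"
  proof
    assume "l dvd a'"
    hence "ord M g dvd a" using og s a' by (auto simp: mult.commute)
    hence "[g ^ a = 1] (mod M)" using ord_divides by blast
    thus False using a nx cong_trans by blast
  qed
  hence "coprime a' l" using l prime_imp_coprime coprime_commute by blast
  then obtain c where c: "[a' * c = 1] (mod l)" using cong_solve_coprime_nat by auto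
  define k where "k = (b' * c) mod l"
  have k: "[a' * k = b'] (mod l)"
  proof -
    have "[a' * k = a' * (b' * c)] (mod l)" unfolding k_def by (intro cong_mult) (auto simp: cong_def)
    also have "a' * (b' * c) = b' * (a' * c)" by simp
    also have "[b' * (a' * c) = b' * 1] (mod l)" by (intro cong_mult c cong_refl)
    finally show ?thesis by simp
  qed
  have "[a * k = b] (mod (s * l))"
    using k unfolding a' b' cong_def by (metis mult.assoc mult_mod_right)
  hence "[g ^ (a * k) = g ^ b] (mod M)"
    using order_divides_expdiff[of M g "a * k" b] og s g by (simp add: residue_primroot_def mult.commute)
  moreover have "[x ^ k = g ^ (a * k)] (mod M)" using a by (metis cong_pow power_mult)
  ultimately have "[u = x ^ k] (mod M)" using b by (meson cong_sym cong_trans)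
  thus ?thesis using l0 unfolding k_def M_def by (metis mod_less_divisor)
qed

section \<open>Multiplicatively dependent solutions\<close>

lemma common_base_of_coprime_powers:
  fixes x y :: nat
  assumes eq: "x ^ A = y ^ B" and cop: "coprime A B" and pos: "B > 0" "x > 0"
  shows "\<exists>c. x = c ^ B \<and> y = c ^ A"
proof -
  have "\<exists>c. x = c ^ B"
  proof (cases "B = 1")
    case False
    \<comment> \<open>Thus \<open>x\<close> is the \<open>B\<close>-th power of the fraction
      \<open>y ^ u / x ^ v\<close>, and divisibility between \<open>B\<close>-th powers makes this
      fraction an integer.\<close>
    obtain u v where uv: "A * u = B * v + 1" using coprime_bezout_strong[OF cop False] by blast
    have "(y ^ u) ^ B = x ^ (A * u)"
      using eq by (metis power_mult mult.commute)
    also have "\<dots> = (x ^ v) ^ B * x" by (simp add: uv flip: power_mult) (simp add: mult.commute)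
    finally have e1: "(y ^ u) ^ B = (x ^ v) ^ B * x" .
    hence "(x ^ v) ^ B dvd (y ^ u) ^ B" by simp
    hence "x ^ v dvd y ^ u" using pos pow_divides_pow_iff by blast
    then obtain c where c: "y ^ u = x ^ v * c" by blast
    have "(x ^ v) ^ B * c ^ B = (x ^ v) ^ B * x" using e1 c by (simp add: power_mult_distrib)
    hence "c ^ B = x" using pos by simp
    thus ?thesis by blast
  qed auto
  then obtain c where c: "x = c ^ B" by blast
  have "y ^ B = (c ^ A) ^ B" using eq c by (metis power_mult mult.commute)
  hence "y = c ^ A" using pos power_eq_iff_eq_base[of B y "c ^ A"] by simp
  with c show ?thesis by blast
qed

text \<open>In lowest terms \<open>x = c ^ B'\<close> and \<open>y = c ^ A'\<close>. Modulo
  \<open>repunit l x\<close> the order of \<open>c\<close> divides \<open>B' * l\<close> and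
  \<open>A' * l\<close>, hence \<open>l\<close>, so \<open>repunit l x < c ^ l\<close>. As
  \<open>repunit l x > x ^ (l - 1)\<close>, only \<open>B' = 1\<close> is possible.\<close>

lemma repunit_dvd_multiplicatively_dependent:
  assumes x: "x \<ge> 2" and y: "y \<ge> 2" and l: "l \<ge> 3"
    and dvd: "repunit l x dvd repunit l y" and eq: "x ^ A = y ^ B" and pos: "A > 0" "B > 0"
  shows "\<exists>r\<ge>1. y = x ^ r"
proof -
  define g where "g = gcd A B"
  have g0: "g > 0" using pos by (simp add: g_def)
  obtain A' B' where AB: "A = A' * g" "B = B' * g" "coprime A' B'"
    unfolding g_def using gcd_coprime_exists[of A B] pos by auto
  have "(x ^ A') ^ g = (y ^ B') ^ g" using eq AB by (simp add: power_mult)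
  hence "x ^ A' = y ^ B'" using g0 power_eq_iff_eq_base[of g "x ^ A'" "y ^ B'"] by simp
  then obtain c where c: "x = c ^ B'" "y = c ^ A'"
    using common_base_of_coprime_powers[of x A' y B'] AB pos x by auto
  have c2: "c \<ge> 2"
  proof (rule ccontr)
    assume "\<not> c \<ge> 2"
    hence "c = 0 \<or> c = 1" by auto
    with c(1) x show False by (auto simp: power_0_left split: if_splits)
  qed
  define N where "N = repunit l x"
  have "[x ^ l = 1] (mod N)" "[y ^ l = 1] (mod N)"
    using cong_1_of_dvd_repunit x y dvd unfolding N_def by auto
  hence "ord N c dvd B' * l" "ord N c dvd A' * l"
    using c by (simp_all add: ord_divides' flip: power_mult)
  hence "ord N c dvd gcd (B' * l) (A' * l)" by simp
  also have "gcd (B' * l) (A' * l) = l"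
    using AB(3) by (metis coprime_imp_gcd_eq_1 gcd.commute gcd_mult_distrib_nat mult.commute mult.right_neutral)
  finally have "[c ^ l = 1] (mod N)" by (simp add: ord_divides')
  hence "N dvd c ^ l - 1" using c2 by (simp add: cong_altdef_nat)
  moreover have "c ^ l > 1" using c2 l by (intro one_less_power) auto
  ultimately have "N < c ^ l" by (metis diff_less dvd_imp_le le_less_trans less_trans zero_less_diff zero_less_one)
  moreover have "x ^ (l - 1) < N" unfolding N_def using repunit_gt x l by simp
  ultimately have "c ^ (B' * (l - 1)) < c ^ l" using c by (simp add: power_mult)
  hence lt: "B' * (l - 1) < l" using c2 by (simp add: power_strict_increasing_iff)
  have "B' = 1"
  proof (rule ccontr)
    assume "B' \<noteq> 1"
    hence "B' \<ge> 2" using AB pos by (cases B') auto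
    hence "2 * (l - 1) \<le> B' * (l - 1)" by (intro mult_right_mono) auto
    with lt l show False by linarith
  qed
  with c have "y = x ^ A'" by simp
  moreover have "A' \<ge> 1" using AB pos by (cases A') auto
  ultimately show ?thesis by blast
qed

lemma repunit_mult_index: "repunit (a * b) x = repunit a (x ^ b) * repunit b x"
proof (induction a)
  case (Suc a)
  have add: "repunit (m + n) x = repunit m x + x ^ m * repunit n x" for m n
    by (induction n) (simp_all add: repunit_Suc algebra_simps power_add repunit_def)
  have "repunit (Suc a * b) x = repunit (a * b + b) x" by (simp add: add.commute)
  also have "\<dots> = repunit (a * b) x + x ^ (a * b) * repunit b x" by (rule add)
  also have "\<dots> = repunit (Suc a) (x ^ b) * repunit b x"
    using Suc by (simp add: repunit_Suc algebra_simps power_mult flip: power_mult)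
  finally show ?case .
qed (simp add: repunit_def)

text \<open>Expand \<open>(1 + p * t) ^ j\<close> to first order: the linear terms add up to
  \<open>p * t\<close> times \<open>p * ((p - 1) div 2)\<close>, which vanishes modulo
  \<open>p\<^sup>2\<close>. So \<open>p\<close> divides \<open>repunit p Y\<close> exactly
  once.\<close>

lemma repunit_prime_mod_square:
  assumes "odd p" "[Y = 1] (mod p)"  "Y \<ge> 1"
  shows "[repunit p Y = p] (mod p\<^sup>2)"
proof -
  obtain t where t: "Y = 1 + p * t" using assms(2,3)
    by (metis cong_sym cong_altdef_nat dvdE le_add_diff_inverse)
  have pw: "[Y ^ j = 1 + j * p * t] (mod p\<^sup>2)" for j
  proof (induction j)
    case (Suc j)
    have "[Y ^ j * Y = (1 + j * p * t) * (1 + p * t)] (mod p\<^sup>2)"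
      using Suc t by (intro cong_mult) auto
    also have "(1 + j * p * t) * (1 + p * t) = (1 + Suc j * p * t) + p\<^sup>2 * (j * t * t)"
      by (simp add: algebra_simps power2_eq_square)
    also have "[\<dots> = (1 + Suc j * p * t) + 0] (mod p\<^sup>2)"
      by (intro cong_add) (auto simp: cong_0_iff)
    finally show ?case by (simp add: mult.commute)
  qed auto
  have "[repunit p Y = (\<Sum>j<p. 1 + j * p * t)] (mod p\<^sup>2)"
    unfolding repunit_def by (intro cong_sum pw)
  also have "(\<Sum>j<p. 1 + j * p * t) = (\<Sum>j<p. 1) + (\<Sum>j<p. p * t * j)"
    unfolding sum.distrib [symmetric] by (intro sum.cong) (auto simp: mult_ac)
  also have "\<dots> = p + p * t * (\<Sum>j<p. j)"
    by (simp add: sum_distrib_left)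
  also have "(\<Sum>j<p. j) = p * ((p - 1) div 2)"
  proof -
    have "(\<Sum>j<p. j) = p * (p - 1) div 2" by (simp add: Sum_Ico_nat lessThan_atLeast0)
    thus ?thesis using assms(1) by (metis div_mult_swap even_diff_nat odd_one odd_pos dvd_diff_nat even_add linorder_not_less odd_even_add odd_two_times_div_two_nat dvd_triv_left)
  qed
  also have "[p + p * t * (p * ((p - 1) div 2)) = p + 0] (mod p\<^sup>2)"
    by (intro cong_add) (auto simp: cong_0_iff power2_eq_square)
  finally show ?thesis by simp
qed

text \<open>Lifting the exponent: with \<open>r = r' * p\<close>, the factor
  \<open>repunit p Y\<close> accounts for a single \<open>p\<close>, and the induction continues
  with \<open>r'\<close> and \<open>Y ^ p\<close>.\<close>

lemma prime_power_dvd_index_of_dvd_repunit: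
  assumes p: "prime p" "odd p"
  shows "[Y = 1] (mod p) \<Longrightarrow> Y \<ge> 1 \<Longrightarrow> p ^ g dvd repunit r Y \<Longrightarrow> p ^ g dvd r"
proof (induction g arbitrary: r Y)
  case (Suc g)
  have "p dvd repunit r Y" using Suc.prems by (meson dvd_power dvd_trans zero_less_Suc)
  hence "p dvd r" using repunit_cong[OF Suc.prems(1), of r] cong_dvd_iff by (auto simp: cong_dvd_iff)
  then obtain r' where r': "r = r' * p" by (metis dvdE mult.commute)
  have c: "[repunit p Y = p] (mod p\<^sup>2)" using repunit_prime_mod_square p Suc.prems by blast
  have "p dvd repunit p Y" using cong_dvd_modulus_nat[OF c, of p] cong_dvd_iff by fastforce
  then obtain w where w: "repunit p Y = p * w" by blast
  have "\<not> p dvd w"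
  proof
    assume "p dvd w"
    hence "p\<^sup>2 dvd repunit p Y" using w by (auto simp: power2_eq_square)
    hence "p\<^sup>2 dvd p" using c cong_dvd_iff by blast
    thus False using p by (metis dvd_mult_cancel1 mult.right_neutral not_prime_unit power2_eq_square prime_gt_0_nat)
  qed
  hence "coprime (p ^ g) w" using p by (simp add: prime_imp_coprime coprime_power_left_iff)
  moreover have "p ^ Suc g dvd repunit r' (Y ^ p) * (p * w)"
    using Suc.prems r' w repunit_mult_index[of r' p Y] by simp
  hence "p ^ g dvd repunit r' (Y ^ p) * w"
    using p by (simp add: mult.left_commute prime_gt_0_nat)
  ultimately have "p ^ g dvd repunit r' (Y ^ p)" using coprime_dvd_mult_left_iff by blast
  moreover have "[Y ^ p = 1] (mod p)" using Suc.prems(1) by (metis cong_pow power_one)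
  ultimately have "p ^ g dvd r'" using Suc.IH[of "Y ^ p" r'] Suc.prems(2) by simp
  thus ?case using r' by simp
qed auto

text \<open>Factoring \<open>repunit (l * r) x\<close> in two ways moves the power of
  \<open>p\<close> to \<open>repunit r (x ^ l)\<close>, whose base is 1 modulo \<open>p\<close>.
  Lifting the exponent then gives \<open>p ^ g \<le> r\<close>, far too small for a ratio of size
  about \<open>x ^ ((l - 1) * (r - 1))\<close>.\<close>

lemma repunit_power_ratio_not_prime_power:
  assumes p: "prime p" "odd p" and l: "l \<ge> 4" and x: "x \<ge> 2" and r: "r \<ge> 1"
    and pd: "p dvd repunit l x" and eq: "repunit l (x ^ r) = p ^ g * repunit l x" and g: "g > 0"
  shows False
proof -
  have Y: "[x ^ l = 1] (mod p)" using cong_1_of_dvd_repunit pd x by simp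
  have "repunit l (x ^ r) * repunit r x = repunit r (x ^ l) * repunit l x"
    using repunit_mult_index[of l r x] repunit_mult_index[of r l x] by (simp add: mult.commute)
  hence "repunit l x * (p ^ g * repunit r x) = repunit l x * repunit r (x ^ l)"
    using eq by (simp add: algebra_simps)
  hence e: "p ^ g * repunit r x = repunit r (x ^ l)" using repunit_pos[of l x] l by simp
  hence "p ^ g dvd repunit r (x ^ l)" by (metis dvd_triv_left)
  hence "p ^ g dvd r" using prime_power_dvd_index_of_dvd_repunit[OF p Y] x by simp
  hence le: "p ^ g \<le> r" using r by (simp add: dvd_imp_le)
  have "p ^ g > 1" using p g prime_gt_1_nat one_less_power by blast
  with le have r2: "r \<ge> 2" by simp
  then obtain s where s: "r = Suc s" "s \<ge> 1" by (cases r) auto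
  have "(x ^ l) ^ s < repunit r (x ^ l)" using repunit_gt[of "x ^ l" r] s x by simp
  also have "\<dots> \<le> r * repunit r x" using e le by (metis mult_le_mono1)
  also have "\<dots> < 2 ^ r * (2 * x ^ s)"
    using repunit_less[OF x, of s] s less_exp[of r] r by (intro mult_strict_mono) auto
  also have "\<dots> = 2 ^ (r + 1) * x ^ s" by simp
  also have "\<dots> \<le> x ^ (r + 1) * x ^ s" using x by (intro mult_right_mono power_mono) auto
  also have "\<dots> = x ^ (2 * r)" using s by (simp add: flip: power_add) (simp add: mult_2)
  finally have "x ^ (l * s) < x ^ (2 * r)" by (simp add: power_mult)
  hence "l * s < 2 * r" using x by (simp add: power_strict_increasing_iff)
  moreover have "4 * s \<le> l * s" using l by simp
  ultimately show False using s by linarith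
qed

subsection \<open>Gaps from the pigeonhole principle\<close>

lemma card_triangle: "card (SIGMA a:{..d}. {..d - a}) * 2 = (d + 1) * (d + (2::nat))"
proof -
  have "card (SIGMA a:{..d}. {..d - a}) = (\<Sum>a\<le>d. d - a + 1)"
    by (subst card_SigmaI) auto
  also have "\<dots> = (\<Sum>a\<le>d. a + 1)"
    by (rule sum.reindex_bij_witness[of _ "\<lambda>a. d - a" "\<lambda>a. d - a"]) auto
  finally have "card (SIGMA a:{..d}. {..d - a}) = (\<Sum>a\<le>d. a + 1)" .
  moreover have "(\<Sum>a\<le>d. a + 1) * 2 = (d + 1) * (d + (2::nat))"
    by (induction d) auto
  ultimately show ?thesis by simp
qed

text \<open>The pigeonhole principle needs more than \<open>l\<close> of the
  \<open>(d + 1) * (d + 2) / 2\<close> monomials of degree at most \<open>d\<close>. The ratio 5/18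
  is attained at \<open>l = 19\<close> with \<open>d = 5\<close>. Primality matters: for 21 and 22
  there is no such \<open>d\<close>.\<close>

lemma exists_monomial_degree:
  assumes "prime l" "l \<ge> 19"
  shows "\<exists>d. 2 * l < (d + 1) * (d + 2) \<and> 18 * d \<le> 5 * (l - (1::nat))"
proof (cases "l \<ge> 23")
  case True
  define d where "d = 5 * (l - 1) div 18"
  have d6: "d \<ge> 6" unfolding d_def using True by linarith
  have "m + 1 \<le> 18 * (m div 18 + 1)" for m :: nat by presburger
  hence "18 * (d + 1) \<ge> 5 * (l - 1) + 1" unfolding d_def .
  moreover have "18 * (d + 1) * 8 \<le> 18 * (d + 1) * (d + 2)" using d6 by (intro mult_left_mono) auto
  ultimately have "2 * l < (d + 1) * (d + 2)" using True by linarith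
  moreover have "18 * d \<le> 5 * (l - 1)" unfolding d_def by simp
  ultimately show ?thesis by blast
next
  case False
  have "l \<noteq> 21" using assms(1) prime_product[of 3 7] by auto
  moreover have "l \<noteq> 22" using assms(1) prime_product[of 2 11] by auto
  ultimately have "l = 19 \<or> l = 20" using False assms(2) by linarith
  thus ?thesis by (intro exI[of _ 5]) auto
qed

lemma monomials_distinct:
  fixes x y :: nat
  assumes x: "x \<ge> 2" and y: "y \<ge> 2" 
    and indep: "\<And>A B. A > 0 \<Longrightarrow> B > 0 \<Longrightarrow> x ^ A \<noteq> y ^ B"
    and eq: "x ^ a * y ^ b = x ^ a' * y ^ b'"
  shows "a = a' \<and> b = b'"
proof -
  have *: "a = a' \<and> b = b'" if eq: "x ^ a * y ^ b = x ^ a' * y ^ b'" and le: "a' \<le> a" for a b a' b'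
  proof -
    obtain c where c: "a = a' + c" using le le_Suc_ex by blast
    have e: "x ^ c * y ^ b = y ^ b'" using eq x by (simp add: c power_add)
    show ?thesis
    proof (cases "c = 0")
      case True
      with e c y show ?thesis by (simp add: power_inject_exp)
    next
      case False
      hence xc: "x ^ c > 1" using x by (intro one_less_power) auto
      have "y ^ b < x ^ c * y ^ b" using xc y by simp
      with e have "y ^ b < y ^ b'" by simp
      hence "b < b'" using y power_strict_increasing_iff[of y b b'] by simp
      then obtain f where f: "b' = b + f" "f > 0" using less_imp_add_positive by blast
      with e y have "x ^ c = y ^ f" by (simp add: power_add mult.commute)
      with indep False f show ?thesis by blast
    qed
  qed
  show ?thesis using *[of a b a' b'] *[of a' b' a b] eq by (cases "a' \<le> a") auto
qed

text \<open>With \<open>y = x ^ k\<close>, the residue of \<open>x ^ a * y ^ b\<close> depends only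
  on \<open>(a + k * b) mod l\<close>, so two of the monomials with \<open>a + b \<le> d\<close> are
  congruent. By independence they differ as integers, and both lie between 1 and
  \<open>y ^ d\<close>.\<close>

lemma modulus_less_power:
  assumes r: "prime r" "prime l" "[r = 1] (mod l)" "l \<ge> 3" and e: "e \<ge> 1"
    and x: "x \<ge> 2" and xy: "x \<le> y"
    and dvd: "r ^ e dvd repunit l x" "r ^ e dvd repunit l y"
    and indep: "\<And>A B. A > 0 \<Longrightarrow> B > 0 \<Longrightarrow> x ^ A \<noteq> y ^ B"
    and d: "2 * l < (d + 1) * (d + 2)"
  shows "r ^ e < y ^ d"
proof -
  define M where "M = r ^ e"
  have y: "y \<ge> 2" using x xy by simp
  have "[y ^ l = 1] (mod M)" unfolding M_def using cong_1_of_dvd_repunit[OF _ dvd(2)] y by simp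
  then obtain k where k: "[y = x ^ k] (mod M)"
    using root_of_unity_eq_power[OF r e _ dvd(1), of y] x unfolding M_def by auto
  have xl: "[x ^ l = 1] (mod M)" unfolding M_def using cong_1_of_dvd_repunit[OF _ dvd(1)] x by simp
  define S where "S = (SIGMA a:{..d}. {..d - a})"
  define f where "f = (\<lambda>(a, b). (a + k * b) mod l)"
  have "f ` S \<subseteq> {..<l}" unfolding f_def using r by auto
  hence "card (f ` S) \<le> l" using card_mono[of "{..<l}" "f ` S"] by simp
  moreover have "card S > l" using card_triangle[of d] d unfolding S_def by linarith
  ultimately have "\<not> inj_on f S" using card_image by fastforce
  then obtain a b a' b' where ab: "(a, b) \<in> S" "(a', b') \<in> S" "(a, b) \<noteq> (a', b')" "f (a, b) = f (a', b')"
    unfolding inj_on_def by auto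
  have mono: "[x ^ a * y ^ b = x ^ ((a + k * b) mod l)] (mod M)" for a b
  proof -
    have "[x ^ a * y ^ b = x ^ a * (x ^ k) ^ b] (mod M)" by (intro cong_mult cong_pow k cong_refl)
    also have "x ^ a * (x ^ k) ^ b = x ^ ((a + k * b) mod l + l * ((a + k * b) div l))"
      unfolding mod_mult_div_eq by (simp add: power_add power_mult)
    also have "\<dots> = x ^ ((a + k * b) mod l) * (x ^ l) ^ ((a + k * b) div l)"
      by (simp only: power_add power_mult)
    also have "[\<dots> = x ^ ((a + k * b) mod l) * 1 ^ ((a + k * b) div l)] (mod M)"
      by (intro cong_mult cong_pow xl cong_refl)
    finally show ?thesis by simp
  qed
  define m1 where "m1 = x ^ a * y ^ b"
  define m2 where "m2 = x ^ a' * y ^ b'"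
  have cong: "[m1 = m2] (mod M)"
    using mono[of a b] mono[of a' b'] ab(4) unfolding f_def m1_def m2_def
    by (simp add: cong_def)
  have "m1 \<noteq> m2"
  proof
    assume "m1 = m2"
    hence eq: "x ^ a * y ^ b = x ^ a' * y ^ b'" by (simp only: m1_def m2_def)
    have "a = a' \<and> b = b'" by (rule monomials_distinct[OF x y _ eq]) (rule indep)
    with ab(3) show False by simp
  qed
  have bound: "x ^ a * y ^ b \<le> y ^ d \<and> x ^ a * y ^ b > 0" if "(a, b) \<in> S" for a b
  proof -
    have "a + b \<le> d" using that unfolding S_def by auto
    have "x ^ a * y ^ b \<le> y ^ a * y ^ b" using xy by (intro mult_right_mono power_mono) auto
    also have "\<dots> \<le> y ^ d" using \<open>a + b \<le> d\<close> y by (simp add: power_increasing flip: power_add)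
    finally show ?thesis using x y by simp
  qed
  have *: "M < y ^ d" if "[m = n] (mod M)" "m < n" "m > 0" "n \<le> y ^ d" for m n
  proof -
    have "M dvd n - m" using cong_altdef_nat[of m n M] cong_sym[OF that(1)] that(2) by simp
    hence "M \<le> n - m" using that by (simp add: dvd_imp_le)
    thus ?thesis using that by linarith
  qed
  have b: "m1 \<le> y ^ d" "m1 > 0" "m2 \<le> y ^ d" "m2 > 0"
    using bound[OF ab(1)] bound[OF ab(2)] by (auto simp: m1_def m2_def)
  have "M < y ^ d"
  proof (cases "m1 < m2")
    case True
    thus ?thesis using *[of m1 m2] cong b by simp
  next
    case False
    hence "m2 < m1" using \<open>m1 \<noteq> m2\<close> by simp
    thus ?thesis using *[of m2 m1] cong b by (simp add: cong_sym)
  qed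
  thus ?thesis by (simp add: M_def)
qed

text \<open>Symmetric residues: an exponent above \<open>l / 2\<close> is replaced by
  \<open>l - k\<close> on the other side. This keeps \<open>x ^ k\<close> well below the modulus to
  which it is applied, so that the congruence forces \<open>y\<close> to be large, and it keeps the
  Pade denominator away from 0.\<close>

lemma small_signed_exponent:
  assumes r: "prime r" "prime l" "[r = 1] (mod l)" "l \<ge> 3" and e: "e \<ge> 1"
    and x: "x \<ge> 2" and y: "y \<ge> 2"
    and dvd: "r ^ e dvd repunit l x" "r ^ e dvd repunit l y"
  shows "\<exists>k>0. 2 * k < l \<and> ([y = x ^ k] (mod r ^ e) \<or> [y * x ^ k = 1] (mod r ^ e))"
proof -
  have "[y ^ l = 1] (mod r ^ e)" using cong_1_of_dvd_repunit[OF _ dvd(2)] y by simp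
  then obtain k where k: "k < l" "[y = x ^ k] (mod r ^ e)"
    using root_of_unity_eq_power[OF r e _ dvd(1), of y] x by auto
  have rd: "r dvd r ^ e" using e by simp
  have "k \<noteq> 0"
  proof
    assume "k = 0"
    with k have "[y = 1] (mod r)" using cong_dvd_modulus_nat rd by fastforce
    thus False using not_cong_1_of_dvd_repunit[OF r(1-3)] dvd rd dvd_trans by blast
  qed
  show ?thesis
  proof (cases "2 * k < l")
    case True
    with k \<open>k \<noteq> 0\<close> show ?thesis by auto
  next
    case False
    have "\<not> 2 * k = l" using r(2,4) primes_dvd_imp_eq[of 2 l] two_is_prime_nat by auto
    hence "2 * (l - k) < l" "l - k > 0" using False k by auto
    have "[y * x ^ (l - k) = x ^ k * x ^ (l - k)] (mod r ^ e)"
      by (intro cong_mult k cong_refl)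
    also have "x ^ k * x ^ (l - k) = x ^ l" using k(1) by (simp flip: power_add)
    also have "[x ^ l = 1] (mod r ^ e)" using cong_1_of_dvd_repunit[OF _ dvd(1)] x by simp
    finally show ?thesis using \<open>2 * (l - k) < l\<close> \<open>l - k > 0\<close> by blast
  qed
qed

subsection \<open>Pade approximations of the binomial function\<close>

text \<open>Compare the coefficients of \<open>X ^ (card V - 1)\<close> in Lagrange's interpolation formula for \<open>f\<close>.\<close>
lemma sum_divided_difference_eq_0:
  fixes V :: "'a :: field set"
  assumes fin: "finite V" and deg: "degree f + 1 < card V"
  shows "(\<Sum>v\<in>V. poly f v / (\<Prod>u\<in>V-{v}. v - u)) = 0"
proof -
  define N where "N = card V - 1"
  define c where "c v = poly f v / (\<Prod>u\<in>V-{v}. v - u)" for v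
  define b where "b v = (\<Prod>u\<in>V-{v}. [:- u, 1:])" for v
  define g where "g = (\<Sum>v\<in>V. smult (c v) (b v)) - f"
  have degb: "degree (b v) = N" and leadb: "coeff (b v) N = 1" if "v \<in> V" for v
  proof -
    have "degree (b v) = (\<Sum>u\<in>V-{v}. degree [:-u, 1:])"
      unfolding b_def by (rule degree_prod_eq_sum_degree) auto
    thus d: "degree (b v) = N" using that fin by (simp add: N_def)
    have "lead_coeff (b v) = 1" unfolding b_def by (simp add: lead_coeff_prod)
    thus "coeff (b v) N = 1" using d by simp
  qed
  have "degree g \<le> N"
    unfolding g_def
    by (intro degree_diff_le degree_sum_le fin order.trans[OF degree_smult_le])
       (use deg degb in \<open>auto simp: N_def\<close>)
  hence degg: "degree g < card V" using deg by (simp add: N_def)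
  have root: "poly g w = 0" if w: "w \<in> V" for w
  proof -
    have "(\<Sum>v\<in>V. c v * poly (b v) w) = (\<Sum>v\<in>{w}. c v * poly (b v) w)"
    proof (rule sum.mono_neutral_right)
      show "\<forall>v\<in>V - {w}. c v * poly (b v) w = 0"
      proof
        fix v assume "v \<in> V - {w}"
        hence "poly (b v) w = 0" unfolding b_def poly_prod using fin w
          by (intro prod_zero) (auto intro!: bexI[of _ w])
        thus "c v * poly (b v) w = 0" by simp
      qed
    qed (use w fin in auto)
    also have "\<dots> = poly f w"
      using fin by (simp add: c_def b_def poly_prod prod_zero_iff)
    finally show ?thesis by (simp add: g_def poly_sum)
  qed
  have "g = 0"
  proof (rule ccontr)
    assume g0: "g \<noteq> 0"
    have "card V \<le> card {w. poly g w = 0}"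
      using root by (intro card_mono poly_roots_finite g0) auto
    also have "\<dots> \<le> degree g" using g0 by (rule card_poly_roots_bound)
    finally show False using degg by simp
  qed
  hence "coeff ((\<Sum>v\<in>V. smult (c v) (b v)) - f) N = 0" by (simp add: g_def)
  moreover have "coeff f N = 0" using deg by (intro coeff_eq_0) (simp add: N_def)
  ultimately have "(\<Sum>v\<in>V. c v) = 0" using leadb by (simp add: coeff_sum)
  thus ?thesis by (simp add: c_def)
qed

text \<open>This is \<open>h ^ n * fact n\<close> times the coefficient \<open>(n + k/h choose j) * (n - k/h choose n - j)\<close> of \<open>w ^ j\<close>
  in the numerator of the \<open>[n/n]\<close> Pade approximation of \<open>w ^ (k/h)\<close> at \<open>w = 1\<close>; the denominator has
  the same coefficients in reverse order.\<close>
definition pade_coeff :: "nat \<Rightarrow> int \<Rightarrow> int \<Rightarrow> nat \<Rightarrow> int" where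
  "pade_coeff n h k j = int (n choose j) * (\<Prod>t<j. k + h * int n - h * int t)
     * (\<Prod>t<n-j. h * int n - k - h * int t)"

lemma pade_coeff_scale:
  assumes "j \<le> n"
  shows "pade_coeff n h (h * s) j = h ^ n * pade_coeff n 1 s j"
proof -
  have 1: "(\<Prod>t<j. h * s + h * int n - h * int t) = h ^ j * (\<Prod>t<j. s + int n - int t)"
    using prod.distrib[of "\<lambda>_. h" "\<lambda>t. s + int n - int t" "{..<j}"]
    by (simp add: algebra_simps)
  have 2: "(\<Prod>t<n-j. h * int n - h * s - h * int t) = h ^ (n-j) * (\<Prod>t<n-j. int n - s - int t)"
    using prod.distrib[of "\<lambda>_. h" "\<lambda>t. int n - s - int t" "{..<n-j}"]
    by (simp add: algebra_simps)
  have "h ^ n = h ^ j * h ^ (n - j)" using assms by (simp flip: power_add)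
  thus ?thesis by (simp add: pade_coeff_def 1 2)
qed

lemma pade_coeff_cong:
  "[k = k'] (mod N) \<Longrightarrow> [pade_coeff n h k j = pade_coeff n h k' j] (mod N)"
  unfolding pade_coeff_def by (intro cong_mult cong_prod cong_add cong_diff cong_refl)

lemma fact_dvd_falling_prod: "fact j dvd (\<Prod>t<j. a - int t)"
  unfolding lessThan_atLeast0 gbinomial_int_mult_fact[of j a, symmetric] by simp

lemma fact_dvd_pade_coeff:
  assumes "j \<le> n"
  shows "fact n dvd pade_coeff n 1 s j"
proof -
  have "(fact n :: int) = int (n choose j) * (fact j * fact (n - j))"
    using binomial_fact_lemma[OF assms] by (metis of_nat_fact of_nat_mult mult.commute)
  also have "\<dots> dvd int (n choose j) * ((\<Prod>t<j. (s + int n) - int t) * (\<Prod>t<n-j. (int n - s) - int t))"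
    by (intro mult_dvd_mono fact_dvd_falling_prod dvd_refl)
  finally show ?thesis by (simp add: pade_coeff_def mult.assoc)
qed

lemma prod_diff_nodes:
  assumes "j \<le> n"
  shows "(\<Prod>i\<in>{..n}-{j}. real j - real i) = (-1) ^ (n - j) * fact j * fact (n - j)"
proof -
  have split: "{..n} - {j} = {..<j} \<union> {Suc j..n}" using assms by auto
  have "(\<Prod>i\<in>{..n}-{j}. real j - real i) = (\<Prod>i<j. real j - real i) * (\<Prod>i\<in>{Suc j..n}. real j - real i)"
    unfolding split by (rule prod.union_disjoint) auto
  also have "(\<Prod>i<j. real j - real i) = (\<Prod>i\<in>{1..j}. real i)"
    by (rule prod.reindex_bij_witness[of _ "\<lambda>i. j - i" "\<lambda>i. j - i"]) auto
  also have "\<dots> = fact j" by (simp add: fact_prod)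
  also have "(\<Prod>i\<in>{Suc j..n}. real j - real i) = (\<Prod>i\<in>{1..n-j}. (-1) * real i)"
    by (rule prod.reindex_bij_witness[of _ "\<lambda>i. i + j" "\<lambda>i. i - j"]) auto
  also have "\<dots> = (-1) ^ (n - j) * fact (n - j)" by (simp only: prod.distrib fact_prod) simp
  finally show ?thesis by simp
qed

lemma prod_falling: "(\<Prod>t<m. (a::real) - real t) = pochhammer (a - real m + 1) m"
  using gbinomial_mult_fact[of m a] by (simp add: lessThan_atLeast0 gbinomial_pochhammer')

lemma prod_falling_minus: "(\<Prod>t<m. (a::real) - real t) = (-1) ^ m * pochhammer (- a) m"
  using gbinomial_mult_fact[of m a] by (simp add: lessThan_atLeast0 gbinomial_pochhammer)

lemma pade_coeff_real:
  "real_of_int (pade_coeff n 1 (int s) j) =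
     real (n choose j) * pochhammer (real s + real n - real j + 1) j * ((-1) ^ (n - j) * pochhammer (real s - real n) (n - j))"
proof -
  have "real_of_int (pade_coeff n 1 (int s) j) = real (n choose j) * (\<Prod>t<j. (real s + real n) - real t)
     * (\<Prod>t<n-j. (real n - real s) - real t)"
    by (simp add: pade_coeff_def)
  thus ?thesis by (simp add: prod_falling[of "real s + real n"] prod_falling_minus[of "real n - real s"])
qed

text \<open>Up to a constant, the Pade coefficients are the Lagrange weights of the nodes
  \<open>0..n\<close> and \<open>s..s+n\<close>. The product
  \<open>W = (s - n) * ... * (s + n)\<close> splits into three consecutive blocks: the middle one
  consists of the distances to the other group of nodes, the outer two come from the
  coefficient.\<close>

lemma pade_coeff_node:
  fixes n s j :: nat
  assumes "j \<le> n"
  defines "W \<equiv> pochhammer (real s - real n) (2 * n + 1)"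
  shows "real_of_int (pade_coeff n 1 (int s) j) *
      ((\<Prod>i\<in>{..n}-{j}. real j - real i) * (\<Prod>i\<le>n. real j - real (s + i))) = - ((-1) ^ n * fact n * W)"
    and "real_of_int (pade_coeff n 1 (int s) (n - j)) *
      ((\<Prod>i\<in>{..n}-{j}. real j - real i) * (\<Prod>i\<le>n. real (s + j) - real i)) = (-1) ^ n * fact n * W"
proof -
  let ?p = "pochhammer :: real \<Rightarrow> nat \<Rightarrow> real"
  have fac: "real (n choose j) * (fact j * fact (n - j)) = fact n"
    using binomial_fact_lemma[OF assms(1)] by (metis of_nat_fact of_nat_mult mult.commute)
  have sg: "(-1 :: real) ^ (n - j) * (-1) ^ (n - j) = 1" by (simp flip: power_mult_distrib)
  have sg2: "(-1 :: real) ^ (n - j) * (-1) ^ j = (-1) ^ n" using assms(1) by (simp flip: power_add)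
  have A: "(\<Prod>i\<le>n. real j - real (s + i)) = (-1) ^ (n + 1) * ?p (real s - real j) (n + 1)"
    using prod_falling_minus[of "real j - real s" "n + 1"] by (simp add: lessThan_Suc_atMost diff_diff_eq)
  have B: "(\<Prod>i\<le>n. real (s + j) - real i) = ?p (real s + real j - real n) (n + 1)"
    using prod_falling[of "real s + real j" "n + 1"] by (simp add: lessThan_Suc_atMost add_diff_eq)
  have W1: "W = ?p (real s - real n) (n - j) * ?p (real s - real j) (n + 1) * ?p (real s + real n - real j + 1) j"
  proof -
    have "W = ?p (real s - real n) ((n - j) + ((n + 1) + j))"
      unfolding W_def using assms(1) by (intro arg_cong[of _ _ "pochhammer _"]) simp
    also have "\<dots> = ?p (real s - real n) (n - j) * (?p (real s - real n + real (n - j)) (n + 1)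
        * ?p (real s - real n + real (n - j) + real (n + 1)) j)"
      by (simp only: pochhammer_product')
    finally show ?thesis using assms(1) by (simp add: of_nat_diff algebra_simps)
  qed
  have W2: "W = ?p (real s - real n) j * ?p (real s + real j - real n) (n + 1) * ?p (real s + real j + 1) (n - j)"
  proof -
    have "W = ?p (real s - real n) (j + ((n + 1) + (n - j)))"
      unfolding W_def using assms(1) by (intro arg_cong[of _ _ "pochhammer _"]) simp
    also have "\<dots> = ?p (real s - real n) j * (?p (real s - real n + real j) (n + 1)
        * ?p (real s - real n + real j + real (n + 1)) (n - j))"
      by (simp only: pochhammer_product')
    finally show ?thesis using assms(1) by (simp add: of_nat_diff algebra_simps)
  qed
  have "real_of_int (pade_coeff n 1 (int s) j) *
      ((\<Prod>i\<in>{..n}-{j}. real j - real i) * (\<Prod>i\<le>n. real j - real (s + i))) =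
      (real (n choose j) * (fact j * fact (n - j))) * ((-1) ^ (n - j) * (-1) ^ (n - j)) * (-1) ^ (n + 1) * W"
    unfolding pade_coeff_real prod_diff_nodes[OF assms(1)] A W1 by (simp only: mult_ac)
  thus "real_of_int (pade_coeff n 1 (int s) j) *
      ((\<Prod>i\<in>{..n}-{j}. real j - real i) * (\<Prod>i\<le>n. real j - real (s + i))) = - ((-1) ^ n * fact n * W)"
    unfolding fac sg by simp
  have nj: "n - (n - j) = j" using assms(1) by simp
  have ch: "n choose (n - j) = n choose j" using assms(1) binomial_symmetric by metis
  have r: "real s + real n - real (n - j) + 1 = real s + real j + 1" using assms(1) by (simp add: of_nat_diff)
  have "real_of_int (pade_coeff n 1 (int s) (n - j)) *
      ((\<Prod>i\<in>{..n}-{j}. real j - real i) * (\<Prod>i\<le>n. real (s + j) - real i)) =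
      (real (n choose j) * (fact j * fact (n - j))) * ((-1) ^ (n - j) * (-1) ^ j) * W"
    unfolding pade_coeff_real prod_diff_nodes[OF assms(1)] B W2 nj ch r by (simp only: mult_ac)
  thus "real_of_int (pade_coeff n 1 (int s) (n - j)) *
      ((\<Prod>i\<in>{..n}-{j}. real j - real i) * (\<Prod>i\<le>n. real (s + j) - real i)) = (-1) ^ n * fact n * W"
    unfolding fac sg2 by (simp only: mult_ac)
qed

text \<open>A divided difference over \<open>2 * n + 2\<close> nodes kills polynomials of degree at
  most \<open>2 * n\<close>. The condition \<open>s > n\<close> keeps the two groups of nodes apart
  and the common constant \<open>K\<close> nonzero.\<close>

lemma pade_moment:
  fixes f :: "real poly"
  assumes s: "s > n" and deg: "degree f \<le> 2 * n"
  shows "(\<Sum>j\<le>n. real_of_int (pade_coeff n 1 (int s) j) * poly f (real j)) =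
         (\<Sum>j\<le>n. real_of_int (pade_coeff n 1 (int s) (n - j)) * poly f (real (s + j)))"
proof -
  define V0 where "V0 = {..n} \<union> (+) s ` {..n}"
  define D where "D v = (\<Prod>u\<in>V0-{v}. real v - real u)" for v
  define K where "K = (-1) ^ n * fact n * pochhammer (real s - real n) (2 * n + 1)"
  have dis: "{..n} \<inter> (+) s ` {..n} = {}" using s by auto
  have fin: "finite V0" by (simp add: V0_def)
  have card: "card V0 = 2 * n + 2"
    unfolding V0_def using dis by (subst card_Un_disjoint) (auto simp: card_image)
  have "(\<Sum>v\<in>real ` V0. poly f v / (\<Prod>u\<in>real ` V0-{v}. v - u)) = 0"
    using fin card deg by (intro sum_divided_difference_eq_0) (auto simp: card_image)
  also have "(\<Sum>v\<in>real ` V0. poly f v / (\<Prod>u\<in>real ` V0-{v}. v - u)) = (\<Sum>v\<in>V0. poly f (real v) / D v)"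
  proof -
    have eqv: "poly f (real v) / (\<Prod>u\<in>real ` V0-{real v}. real v - u) = poly f (real v) / D v" for v
    proof -
      have "real ` V0 - {real v} = real ` (V0 - {v})" by auto
      thus ?thesis by (simp add: D_def prod.reindex)
    qed
    have "(\<Sum>v\<in>V0. poly f (real v) / D v) = (\<Sum>v\<in>V0. poly f (real v) / (\<Prod>u\<in>real ` V0-{real v}. real v - u))"
      by (intro sum.cong refl eqv[symmetric])
    also have "\<dots> = (\<Sum>v\<in>real ` V0. poly f v / (\<Prod>u\<in>real ` V0-{v}. v - u))"
      by (subst sum.reindex) auto
    finally show ?thesis by (rule sym)
  qed
  also have "\<dots> = (\<Sum>j\<le>n. poly f (real j) / D j) + (\<Sum>j\<le>n. poly f (real (s + j)) / D (s + j))"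
    unfolding V0_def using dis by (subst sum.union_disjoint) (auto simp: sum.reindex)
  finally have zero: "(\<Sum>j\<le>n. poly f (real j) / D j) + (\<Sum>j\<le>n. poly f (real (s + j)) / D (s + j)) = 0" .
  have K0: "K \<noteq> 0"
    using s unfolding K_def by (auto simp: pochhammer_eq_0_iff)
  have D1: "real_of_int (pade_coeff n 1 (int s) j) = - K / D j" if j: "j \<le> n" for j
  proof -
    have "V0 - {j} = ({..n}-{j}) \<union> (+) s ` {..n}" using s j by (auto simp: V0_def)
    hence "D j = (\<Prod>i\<in>{..n}-{j}. real j - real i) * (\<Prod>i\<le>n. real j - real (s + i))"
      unfolding D_def using dis by (simp only:) (subst prod.union_disjoint, auto simp: prod.reindex)
    hence "real_of_int (pade_coeff n 1 (int s) j) * D j = - K"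
      using pade_coeff_node(1)[OF j, of s] by (simp add: K_def)
    thus ?thesis using K0 by (metis mult_zero_right neg_equal_0_iff_equal nonzero_eq_divide_eq)
  qed
  have D2: "real_of_int (pade_coeff n 1 (int s) (n - j)) = K / D (s + j)" if j: "j \<le> n" for j
  proof -
    have "V0 - {s + j} = {..n} \<union> (+) s ` ({..n} - {j})" using s j by (auto simp: V0_def)
    moreover have "{..n} \<inter> (+) s ` ({..n} - {j}) = {}" using dis by auto
    ultimately have "D (s + j) = (\<Prod>i\<le>n. real (s + j) - real i) * (\<Prod>i\<in>{..n}-{j}. real j - real i)"
      unfolding D_def by (simp only:) (subst prod.union_disjoint, auto simp: prod.reindex)
    hence "real_of_int (pade_coeff n 1 (int s) (n - j)) * D (s + j) = K"
      using pade_coeff_node(2)[OF j, of s] by (simp add: K_def mult.commute)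
    thus ?thesis using K0 by (metis mult_zero_right nonzero_eq_divide_eq)
  qed
  have "(\<Sum>j\<le>n. real_of_int (pade_coeff n 1 (int s) j) * poly f (real j)) = - K * (\<Sum>j\<le>n. poly f (real j) / D j)"
    using D1 by (simp add: sum_distrib_left sum_negf)
  also have "\<dots> = K * (\<Sum>j\<le>n. poly f (real (s + j)) / D (s + j))"
    using zero by (simp add: add_eq_0_iff)
  also have "\<dots> = (\<Sum>j\<le>n. real_of_int (pade_coeff n 1 (int s) (n - j)) * poly f (real (s + j)))"
    using D2 by (simp add: sum_distrib_left)
  finally show ?thesis .
qed

text \<open>For \<open>h = 1\<close> and a natural number \<open>s\<close> this is the Pade approximation of \<open>w ^ s\<close> at \<open>w = 1\<close>:
  the coefficient of \<open>(w - 1) ^ i\<close> is a moment of the polynomial \<open>\<lambda>t. t choose i\<close>.\<close>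
lemma pade_approximation_dvd:
  fixes w :: int
  assumes s: "s > n"
  shows "fact n * (w - 1) ^ (2 * n + 1) dvd
    (\<Sum>j\<le>n. pade_coeff n 1 (int s) j * w ^ j) - w ^ s * (\<Sum>j\<le>n. pade_coeff n 1 (int s) (n - j) * w ^ j)"
proof -
  define A where "A = pade_coeff n 1 (int s)"
  define c where "c i = (\<Sum>j\<le>n. A j * int (j choose i)) - (\<Sum>j\<le>n. A (n - j) * int ((s + j) choose i))" for i
  have pow: "w ^ v = (\<Sum>i\<le>s+n. int (v choose i) * (w - 1) ^ i)" if "v \<le> s + n" for v
  proof -
    have "w ^ v = ((w - 1) + 1) ^ v" by simp
    also have "\<dots> = (\<Sum>i\<le>v. int (v choose i) * (w - 1) ^ i)" by (subst binomial_ring) simp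
    also have "\<dots> = (\<Sum>i\<le>s+n. int (v choose i) * (w - 1) ^ i)"
      using that by (intro sum.mono_neutral_left) auto
    finally show ?thesis .
  qed
  have "(\<Sum>j\<le>n. A j * w ^ j) = (\<Sum>j\<le>n. \<Sum>i\<le>s+n. (w - 1) ^ i * (A j * int (j choose i)))"
    using pow by (intro sum.cong) (auto simp: sum_distrib_left mult_ac)
  also have "\<dots> = (\<Sum>i\<le>s+n. (w - 1) ^ i * (\<Sum>j\<le>n. A j * int (j choose i)))"
    by (subst sum.swap) (simp add: sum_distrib_left)
  finally have e1: "(\<Sum>j\<le>n. A j * w ^ j) = (\<Sum>i\<le>s+n. (w - 1) ^ i * (\<Sum>j\<le>n. A j * int (j choose i)))" .
  have "w ^ s * (\<Sum>j\<le>n. A (n - j) * w ^ j) = (\<Sum>j\<le>n. A (n - j) * w ^ (s + j))"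
    by (simp add: sum_distrib_left power_add mult_ac)
  also have "\<dots> = (\<Sum>j\<le>n. \<Sum>i\<le>s+n. (w - 1) ^ i * (A (n - j) * int ((s + j) choose i)))"
    using pow by (intro sum.cong) (auto simp: sum_distrib_left mult_ac)
  also have "\<dots> = (\<Sum>i\<le>s+n. (w - 1) ^ i * (\<Sum>j\<le>n. A (n - j) * int ((s + j) choose i)))"
    by (subst sum.swap) (simp add: sum_distrib_left)
  finally have e2: "w ^ s * (\<Sum>j\<le>n. A (n - j) * w ^ j) =
    (\<Sum>i\<le>s+n. (w - 1) ^ i * (\<Sum>j\<le>n. A (n - j) * int ((s + j) choose i)))" .
  have eq: "(\<Sum>j\<le>n. A j * w ^ j) - w ^ s * (\<Sum>j\<le>n. A (n - j) * w ^ j) = (\<Sum>i\<le>s+n. (w - 1) ^ i * c i)"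
    unfolding e1 e2 c_def by (simp add: sum_subtractf right_diff_distrib)
  have c0: "c i = 0" if i: "i \<le> 2 * n" for i
  proof -
    \<comment> \<open>At natural numbers \<open>f\<close> takes the values
      \<open>fact i * (v choose i)\<close>, so the moment identity annihilates this
      coefficient.\<close>
    define f :: "real poly" where "f = (\<Prod>t<i. [:- real t, 1:])"
    have "degree f = (\<Sum>t<i. degree [:- real t, 1:])"
      unfolding f_def by (rule degree_prod_eq_sum_degree) auto
    hence "degree f \<le> 2 * n" using i by simp
    note m = pade_moment[OF s this]
    have f: "poly f (real v) = fact i * real (v choose i)" for v
      using gbinomial_mult_fact[of i "real v"]
      by (simp add: f_def poly_prod binomial_gbinomial lessThan_atLeast0)
    have "fact i * real_of_int (c i) = 0"
      using m unfolding f c_def A_def by (simp add: sum_distrib_left right_diff_distrib mult_ac)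
    thus ?thesis by simp
  qed
  \<comment> \<open>This factor is retained to compensate for the factorial size of the Pade
    coefficients.\<close>
  have cd: "fact n dvd c i" for i
    unfolding c_def A_def
    by (intro dvd_diff dvd_sum dvd_mult2 fact_dvd_pade_coeff) auto
  have "fact n * (w - 1) ^ (2 * n + 1) dvd (\<Sum>i\<le>s+n. (w - 1) ^ i * c i)"
  proof (rule dvd_sum)
    fix i
    show "fact n * (w - 1) ^ (2 * n + 1) dvd (w - 1) ^ i * c i"
    proof (cases "i \<le> 2 * n")
      case False
      hence "(w - 1) ^ (2 * n + 1) dvd (w - 1) ^ i" by (intro le_imp_power_dvd) auto
      thus ?thesis using cd by (subst mult.commute) (rule mult_dvd_mono)
    qed (use c0 in auto)
  qed
  thus ?thesis unfolding eq[symmetric] A_def .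
qed

section \<open>The Pade congruence modulo a prime power\<close>

lemma prime_power_dvd_diff_of_power_cong:
  fixes a b p :: int
  assumes p: "prime p" and cong: "[a ^ l = b ^ l] (mod p ^ e)" "[a = b] (mod p)"
    and nd: "\<not> p dvd b" "\<not> p dvd int l"
  shows "[a = b] (mod p ^ e)"
proof -
  \<comment> \<open>\<open>a ^ l - b ^ l = (a - b) * S\<close>, and \<open>S\<close> is
    \<open>l * b ^ (l - 1)\<close> modulo \<open>p\<close>, hence a unit: an \<open>l\<close>-th
    root modulo \<open>p ^ e\<close> is determined by its residue modulo \<open>p\<close>.\<close>
  define S where "S = (\<Sum>i<l. b ^ (l - Suc i) * a ^ i)"
  have "[S = (\<Sum>i<l. b ^ (l - Suc i) * b ^ i)] (mod p)"
    unfolding S_def by (intro cong_sum cong_mult cong_pow cong cong_refl)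
  also have "(\<Sum>i<l. b ^ (l - Suc i) * b ^ i) = int l * b ^ (l - 1)"
    by (simp flip: power_add)
  finally have "[S = int l * b ^ (l - 1)] (mod p)" .
  moreover have "\<not> p dvd int l * b ^ (l - 1)"
    using nd p prime_dvd_mult_iff prime_dvd_power by blast
  ultimately have "\<not> p dvd S" using cong_dvd_iff by blast
  hence "coprime (p ^ e) S" using p by (simp add: prime_imp_coprime coprime_power_left_iff)
  moreover have "p ^ e dvd (a - b) * S"
    using cong(1) power_diff_sumr2[of a l b] unfolding S_def by (simp add: cong_iff_dvd_diff)
  ultimately have "p ^ e dvd a - b" using coprime_dvd_mult_left_iff by blast
  thus ?thesis by (simp add: cong_iff_dvd_diff)
qed

text \<open>Each further \<open>p\<close>-th power gains a factor \<open>p\<close>, because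
  \<open>1 + v + ... + v ^ (p - 1)\<close> is 0 modulo \<open>p\<close>. Exponents of
  \<open>w\<close> may therefore be changed by multiples of \<open>p ^ e\<close>, which gives a
  meaning to \<open>w ^ (k / l)\<close>.\<close>

lemma prime_power_exponent_cong_1:
  fixes w p :: int
  assumes "[w = 1] (mod p)"
  shows "[w ^ (nat p ^ e) = 1] (mod p ^ e)"
proof (cases "p \<ge> 0")
  case p: True
  show ?thesis
  proof (induction e)
    case (Suc e)
    define v where "v = w ^ (nat p ^ e)"
    have v1: "[v = 1] (mod p)" unfolding v_def using assms by (metis cong_pow power_one)
    have "[(\<Sum>i<nat p. v ^ i) = (\<Sum>i<nat p. 1 ^ i)] (mod p)"
      by (intro cong_sum cong_pow v1)
    hence "p dvd (\<Sum>i<nat p. v ^ i)" using p by (simp add: cong_dvd_iff)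
    moreover have "p ^ e dvd v - 1" using Suc by (simp add: v_def cong_iff_dvd_diff)
    ultimately have "p ^ e * p dvd (v - 1) * (\<Sum>i<nat p. v ^ i)" by (rule mult_dvd_mono[rotated])
    also have "(v - 1) * (\<Sum>i<nat p. v ^ i) = v ^ nat p - 1" by (simp add: power_diff_1_eq)
    finally have "p ^ Suc e dvd v ^ nat p - 1" by (simp add: mult.commute)
    moreover have "v ^ nat p = w ^ (nat p ^ Suc e)"
      by (simp add: v_def mult.commute flip: power_mult)
    ultimately show ?case by (simp add: cong_iff_dvd_diff)
  qed simp
next
  case False
  thus ?thesis using assms by (cases "e = 0") (auto simp: power_0_left)
qed

definition pade_num :: "nat \<Rightarrow> int \<Rightarrow> int \<Rightarrow> int \<Rightarrow> int" where
  "pade_num n h k w = (\<Sum>j\<le>n. pade_coeff n h k j * w ^ j)"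

definition pade_den :: "nat \<Rightarrow> int \<Rightarrow> int \<Rightarrow> int \<Rightarrow> int" where
  "pade_den n h k w = (\<Sum>j\<le>n. pade_coeff n h k (n - j) * w ^ j)"

text \<open>Replacing \<open>k / l\<close> by an integer \<open>s\<close> with \<open>l * s = k\<close> modulo the target modulus makes the
  binomial series a polynomial, whose Pade coefficients are divisible by \<open>fact n\<close>.\<close>
lemma pade_congruence:
  fixes p w \<alpha> \<beta> :: int and n l k v u a b :: nat
  assumes p: "prime p" and l: "prime l" and pl: "\<not> p dvd int l"
    and w: "p ^ a dvd w - 1" "a > 0" and ab: "b \<le> (2 * n + 1) * a"
    and u: "fact n = l ^ v * u" "coprime u l"
    and eq: "[\<alpha> ^ l * w ^ k = \<beta> ^ l] (mod p ^ b)" "[\<alpha> = \<beta>] (mod p)" "\<not> p dvd \<beta>"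
  shows "int u * p ^ b dvd \<alpha> * pade_num n (int l) (int k) w - \<beta> * pade_den n (int l) (int k) w"
proof -
  have p0: "p > 0" using p prime_gt_0_int by blast
  \<comment> \<open>Of \<open>fact n\<close> only the part prime to \<open>l\<close> enters the
    modulus, so that \<open>l\<close> is invertible.\<close>
  define N where "N = u * nat p ^ b"
  have u0: "u > 0" using u(1) by (metis fact_nonzero gr0I mult_zero_right)
  have N0: "N > 0" unfolding N_def using u0 p0 by simp
  have intN: "int N = int u * p ^ b" unfolding N_def using p0 by simp
  have "coprime (nat p) l"
  proof -
    have "coprime p (int l)" using p pl by (simp add: prime_imp_coprime)
    thus ?thesis using p0 by (metis coprime_int_iff int_nat_eq less_imp_le)
  qed
  hence "coprime N l" unfolding N_def using u(2) by simp
  hence "\<exists>s0. [l * s0 = 1] (mod N)" using cong_solve_coprime_nat[of l N] by (auto simp: coprime_commute)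
  then obtain s0 where s0: "[l * s0 = 1] (mod N)" by blast
  \<comment> \<open>The added multiple of \<open>N\<close> makes \<open>s > n\<close>, as the Pade
    approximation requires, and \<open>s \<ge> k\<close>, so that \<open>l * s - k\<close> is a
    natural number.\<close>
  define s where "s = s0 * k + (n + k + 1) * N"
  have "(n + k + 1) * 1 \<le> (n + k + 1) * N" using N0 by (intro mult_left_mono) auto
  hence "n + k + 1 \<le> s" unfolding s_def mult_1_right by (rule trans_le_add2)
  hence sn: "s > n" "s \<ge> k" by simp_all
  have ls: "[l * s = k] (mod N)"
  proof -
    have "l * s = (l * s0) * k + (l * (n + k + 1)) * N" by (simp add: s_def algebra_simps)
    also have "[\<dots> = 1 * k + 0] (mod N)" by (intro cong_add cong_mult s0 cong_refl) (simp add: cong_0_iff)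
    finally show ?thesis by simp
  qed
  have "k \<le> l * s" using sn(2) l by (metis le_trans mult.commute mult_le_mono2 nat_mult_1_right prime_ge_1_nat)
  moreover have "nat p ^ b dvd N" by (simp add: N_def)
  ultimately obtain t where t: "l * s = k + nat p ^ b * t"
    using ls by (metis cong_altdef_nat dvdE dvd_trans le_add_diff_inverse)
  have w1: "[w = 1] (mod p)"
    using w by (metis cong_iff_dvd_diff dvd_power dvd_trans)
  have wp: "[w ^ (l * s) = w ^ k] (mod p ^ b)"
  proof -
    have "w ^ (l * s) = w ^ k * (w ^ (nat p ^ b)) ^ t" by (simp add: t power_add power_mult)
    also have "[\<dots> = w ^ k * 1 ^ t] (mod p ^ b)"
      by (intro cong_mult cong_pow cong_refl prime_power_exponent_cong_1 w1)
    finally show ?thesis by simp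
  qed
  have "[(\<alpha> * w ^ s) ^ l = \<beta> ^ l] (mod p ^ b)"
  proof -
    have "(\<alpha> * w ^ s) ^ l = \<alpha> ^ l * w ^ (l * s)" by (simp add: power_mult_distrib mult.commute flip: power_mult)
    also have "[\<dots> = \<alpha> ^ l * w ^ k] (mod p ^ b)" by (intro cong_mult wp cong_refl)
    finally show ?thesis using eq(1) cong_trans by blast
  qed
  moreover have "[\<alpha> * w ^ s = \<beta> * 1 ^ s] (mod p)" by (intro cong_mult cong_pow eq w1)
  hence "[\<alpha> * w ^ s = \<beta>] (mod p)" by simp
  ultimately have ws: "p ^ b dvd \<alpha> * w ^ s - \<beta>"
    using prime_power_dvd_diff_of_power_cong[OF p _ _ eq(3) pl] by (simp add: cong_iff_dvd_diff)
  have coeff: "[pade_coeff n (int l) (int k) j = int l ^ n * pade_coeff n 1 (int s) j] (mod int N)" if "j \<le> n" for j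
  proof -
    have "[int k = int l * int s] (mod int N)" using ls by (metis cong_int_iff cong_sym of_nat_mult)
    from pade_coeff_cong[OF this] show ?thesis
      unfolding pade_coeff_scale[OF that, of "int l" "int s", symmetric] .
  qed
  have num: "[pade_num n (int l) (int k) w = int l ^ n * pade_num n 1 (int s) w] (mod int N)"
    unfolding pade_num_def sum_distrib_left mult.assoc[symmetric]
    by (intro cong_sum cong_mult cong_refl coeff) auto
  have den: "[pade_den n (int l) (int k) w = int l ^ n * pade_den n 1 (int s) w] (mod int N)"
    unfolding pade_den_def sum_distrib_left mult.assoc[symmetric]
    by (intro cong_sum cong_mult cong_refl coeff) auto
  have uf: "int u dvd fact n" using u(1) by (metis dvd_triv_right of_nat_dvd_iff of_nat_fact)
  have pw: "p ^ b dvd (w - 1) ^ (2 * n + 1)"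
  proof -
    have "p ^ b dvd p ^ (a * (2 * n + 1))" using ab by (intro le_imp_power_dvd) (simp add: mult.commute)
    also have "\<dots> dvd (w - 1) ^ (2 * n + 1)" unfolding power_mult by (rule dvd_power_same[OF w(1)])
    finally show ?thesis .
  qed
  have d1: "int u * p ^ b dvd pade_num n 1 (int s) w - w ^ s * pade_den n 1 (int s) w"
    using mult_dvd_mono[OF uf pw] pade_approximation_dvd[OF sn(1), of w] dvd_trans
    unfolding pade_num_def pade_den_def by blast
  have "fact n dvd pade_den n 1 (int s) w"
    unfolding pade_den_def by (intro dvd_sum dvd_mult2 fact_dvd_pade_coeff) auto
  hence d2: "int u * p ^ b dvd pade_den n 1 (int s) w * (\<alpha> * w ^ s - \<beta>)"
    using uf ws by (intro mult_dvd_mono) (auto intro: dvd_trans)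
  \<comment> \<open>The term \<open>w ^ s\<close> cancels. The first summand is small by the Pade
    approximation; in the second, \<open>u\<close> comes from the denominator and
    \<open>p ^ b\<close> from the root.\<close>
  have "int N dvd int l ^ n * (\<alpha> * (pade_num n 1 (int s) w - w ^ s * pade_den n 1 (int s) w)
      + pade_den n 1 (int s) w * (\<alpha> * w ^ s - \<beta>))"
    unfolding intN by (intro dvd_mult dvd_add d1 d2)
  also have "int l ^ n * (\<alpha> * (pade_num n 1 (int s) w - w ^ s * pade_den n 1 (int s) w)
      + pade_den n 1 (int s) w * (\<alpha> * w ^ s - \<beta>)) =
    \<alpha> * (int l ^ n * pade_num n 1 (int s) w) - \<beta> * (int l ^ n * pade_den n 1 (int s) w)"
    by (simp add: algebra_simps)
  finally have "int N dvd \<dots>" .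
  moreover have "[\<alpha> * pade_num n (int l) (int k) w - \<beta> * pade_den n (int l) (int k) w =
     \<alpha> * (int l ^ n * pade_num n 1 (int s) w) - \<beta> * (int l ^ n * pade_den n 1 (int s) w)] (mod int N)"
    by (intro cong_diff cong_mult cong_refl num den)
  ultimately show ?thesis unfolding intN[symmetric] by (simp add: cong_dvd_iff)
qed

text \<open>The multiples of \<open>l\<close> up to \<open>n\<close> contribute
  \<open>l ^ (n div l) * fact (n div l)\<close>, the rest is prime to \<open>l\<close>. Recursion
  gives \<open>v \<le> 2 * (n div l) \<le> n\<close>, so the part of \<open>fact n\<close> that
  cannot be cancelled costs at most \<open>l ^ n\<close>.\<close>

lemma fact_prime_part:
  assumes l: "prime (l::nat)"
  shows "\<exists>v u. fact n = l ^ v * u \<and> coprime u l \<and> v \<le> n"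
proof (induction n rule: less_induct)
  case (less n)
  have l2: "l \<ge> 2" using l prime_ge_2_nat by blast
  have "\<exists>R. (fact n :: nat) = l ^ (n div l) * fact (n div l) * R \<and> coprime R l"
  proof (induction n)
    case (Suc n)
    then obtain R where R: "(fact n :: nat) = l ^ (n div l) * fact (n div l) * R" "coprime R l" by blast
    show ?case
    proof (cases "l dvd Suc n")
      case True
      hence d: "Suc n div l = Suc (n div l)" by (simp add: div_Suc dvd_eq_mod_eq_0)
      hence "Suc n = l * Suc (n div l)" using True by (metis dvd_mult_div_cancel)
      hence "(fact (Suc n) :: nat) = l ^ (Suc n div l) * fact (Suc n div l) * R"
        unfolding d fact_Suc R(1) by (simp only: of_nat_id power_Suc fact_Suc mult_ac)
      with R show ?thesis by blast
    next
      case False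
      hence "Suc n div l = n div l" by (simp add: div_Suc dvd_eq_mod_eq_0)
      moreover have "coprime (Suc n * R) l"
        using False l R(2) by (metis coprime_commute coprime_mult_left_iff prime_imp_coprime)
      ultimately show ?thesis using R(1) by (intro exI[of _ "Suc n * R"]) (simp add: algebra_simps)
    qed
  qed auto
  then obtain R where R: "(fact n :: nat) = l ^ (n div l) * fact (n div l) * R" "coprime R l" by blast
  show ?case
  proof (cases "n = 0")
    case False
    hence "n div l < n" using l2 by simp
    then obtain v u where vu: "fact (n div l) = l ^ v * u" "coprime u l" "v \<le> n div l" using less.IH by blast
    have "n div l * 2 \<le> n div l * l" using l2 by simp
    also have "\<dots> \<le> n" by simp
    finally have "n div l + v \<le> n" using vu(3) by linarith
    moreover have "fact n = l ^ (n div l + v) * (u * R)" using R(1) vu(1) by (simp add: power_add mult_ac)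
    moreover have "coprime (u * R) l" using vu R by simp
    ultimately show ?thesis by blast
  qed (auto intro!: exI[of _ 0] exI[of _ 1])
qed

section \<open>Real size of the Pade numerator and denominator\<close>

lemma prod_consecutive:
  assumes "j \<le> N"
  shows "(\<Prod>t<j. int N - int t) = fact j * int (N choose j)"
  using gbinomial_int_mult_fact[of j "int N"] gbinomial_int_binomial[of N j] by (simp add: lessThan_atLeast0)

lemma pade_coeff_nonneg:
  assumes k: "0 < k" "2 * k < l" and j: "j \<le> n"
  shows "pade_coeff n (int l) (int k) j \<ge> 0"
proof -
  have "int k + int l * int n - int l * int t \<ge> 0" if "t < j" for t
  proof -
    have "int l * int t \<le> int l * int n" using that j by (intro mult_left_mono) auto
    thus ?thesis by linarith
  qed
  moreover have "int l * int n - int k - int l * int t \<ge> 0" if "t < n - j" for t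
  proof -
    have "int l * (int t + 1) \<le> int l * int n" using that j by (intro mult_left_mono) auto
    hence "int l * int t + int l \<le> int l * int n" by (simp add: algebra_simps)
    thus ?thesis using k by linarith
  qed
  ultimately show ?thesis unfolding pade_coeff_def by (intro mult_nonneg_nonneg prod_nonneg) auto
qed

text \<open>Replace \<open>k\<close> by \<open>l\<close> in the first product and by 0 in the
  second; both become factorials times binomial coefficients.\<close>

lemma pade_coeff_le:
  assumes k: "0 < k" "2 * k < l" and j: "j \<le> n"
  shows "pade_coeff n (int l) (int k) j \<le> int l ^ n * fact n * (int ((n + 1) choose j) * 2 ^ n)"
proof -
  have 1: "(\<Prod>t<j. int k + int l * int n - int l * int t) \<le> int l ^ j * (fact j * int ((n + 1) choose j))"
  proof -
    have "(\<Prod>t<j. int k + int l * int n - int l * int t) \<le> (\<Prod>t<j. int l * (int (n + 1) - int t))"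
    proof (rule prod_mono)
      fix t assume "t \<in> {..<j}"
      hence "int l * int t \<le> int l * int n" using j by (intro mult_left_mono) auto
      moreover have "int l * (int (n + 1) - int t) = int l * int n + int l - int l * int t"
        by (simp add: algebra_simps)
      ultimately show "0 \<le> int k + int l * int n - int l * int t \<and> int k + int l * int n - int l * int t \<le> int l * (int (n + 1) - int t)"
        using k by linarith
    qed
    also have "\<dots> = int l ^ j * (\<Prod>t<j. int (n + 1) - int t)" by (simp add: prod.distrib)
    also have "\<dots> = int l ^ j * (fact j * int ((n + 1) choose j))" using j by (subst prod_consecutive) auto
    finally show ?thesis .
  qed
  have 2: "0 \<le> (\<Prod>t<n-j. int l * int n - int k - int l * int t) \<and>
    (\<Prod>t<n-j. int l * int n - int k - int l * int t) \<le> int l ^ (n - j) * (fact (n - j) * int (n choose j))"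
  proof -
    have b: "0 \<le> int l * int n - int k - int l * int t \<and> int l * int n - int k - int l * int t \<le> int l * (int n - int t)"
      if "t < n - j" for t
    proof -
      have "int l * (int t + 1) \<le> int l * int n" using that j by (intro mult_left_mono) auto
      hence "int l * int t + int l \<le> int l * int n" by (simp add: algebra_simps)
      moreover have "int l * (int n - int t) = int l * int n - int l * int t" by (simp add: algebra_simps)
      ultimately show ?thesis using k by linarith
    qed
    have "(\<Prod>t<n-j. int l * int n - int k - int l * int t) \<le> (\<Prod>t<n-j. int l * (int n - int t))"
      using b by (intro prod_mono) auto
    also have "\<dots> = int l ^ (n - j) * (\<Prod>t<n-j. int n - int t)" by (simp add: prod.distrib)
    also have "\<dots> = int l ^ (n - j) * (fact (n - j) * int (n choose (n - j)))" by (subst prod_consecutive) auto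
    also have "n choose (n - j) = n choose j" using j binomial_symmetric by metis
    finally show ?thesis using b by (auto intro: prod_nonneg)
  qed
  have fac: "(fact n :: int) = int (n choose j) * (fact j * fact (n - j))"
    using binomial_fact_lemma[OF j] by (metis of_nat_fact of_nat_mult mult.commute)
  have ln: "int l ^ n = int l ^ j * int l ^ (n - j)" using j by (simp flip: power_add)
  have "pade_coeff n (int l) (int k) j \<le> int (n choose j) * (int l ^ j * (fact j * int ((n + 1) choose j)))
      * (int l ^ (n - j) * (fact (n - j) * int (n choose j)))"
    unfolding pade_coeff_def using 1 2 by (intro mult_mono mult_left_mono) auto
  also have "\<dots> = int l ^ n * fact n * (int ((n + 1) choose j) * int (n choose j))"
    unfolding fac ln by (simp only: mult_ac)
  also have "\<dots> \<le> int l ^ n * fact n * (int ((n + 1) choose j) * 2 ^ n)"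
  proof -
    have "int (n choose j) \<le> int (2 ^ n)" using binomial_le_pow2 by (simp only: of_nat_le_iff)
    thus ?thesis by (intro mult_left_mono) auto
  qed
  finally show ?thesis .
qed

lemma sum_pade_coeff_le:
  assumes k: "0 < k" "2 * k < l" and n: "n \<ge> 1"
  shows "(\<Sum>j\<le>n. pade_coeff n (int l) (int k) j) \<le> (8 * int l) ^ n * fact n"
proof -
  have "(\<Sum>j\<le>n. pade_coeff n (int l) (int k) j) \<le> (\<Sum>j\<le>n. int l ^ n * fact n * (int ((n + 1) choose j) * 2 ^ n))"
    using pade_coeff_le[OF k] by (intro sum_mono) auto
  also have "\<dots> = int l ^ n * fact n * 2 ^ n * int (\<Sum>j\<le>n. (n + 1) choose j)"
    by (simp add: sum_distrib_left mult_ac)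
  also have "(\<Sum>j\<le>n. (n + 1) choose j) \<le> (\<Sum>j\<le>n+1. (n + 1) choose j)" by (intro sum_mono2) auto
  hence "int l ^ n * fact n * 2 ^ n * int (\<Sum>j\<le>n. (n + 1) choose j) \<le> int l ^ n * fact n * 2 ^ n * int (2 ^ (n + 1))"
    using choose_row_sum[of "n + 1"] by (intro mult_left_mono) (simp_all only: of_nat_le_iff, auto)
  also have "\<dots> \<le> int l ^ n * fact n * 2 ^ n * 4 ^ n"
  proof -
    have "(2 :: int) ^ (n + 1) \<le> 2 ^ (2 * n)" using n by (intro power_increasing) auto
    also have "\<dots> = 4 ^ n" by (simp add: power_mult)
    finally show ?thesis by (intro mult_left_mono) auto
  qed
  also have "\<dots> = (8 * int l) ^ n * fact n"
  proof -
    have "(8::int) ^ n = 2 ^ n * 4 ^ n" by (simp flip: power_mult_distrib)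
    thus ?thesis by (simp add: power_mult_distrib)
  qed
  finally show ?thesis .
qed

lemma pade_upper:
  assumes k: "0 < k" "2 * k < l" and n: "n \<ge> 1" and w: "w \<ge> 1"
  shows "pade_num n (int l) (int k) w \<le> (8 * int l) ^ n * fact n * w ^ n"
    and "pade_den n (int l) (int k) w \<le> (8 * int l) ^ n * fact n * w ^ n"
proof -
  note nn = pade_coeff_nonneg[OF k]
  have "pade_num n (int l) (int k) w \<le> (\<Sum>j\<le>n. pade_coeff n (int l) (int k) j * w ^ n)"
    unfolding pade_num_def using w nn by (intro sum_mono mult_left_mono power_increasing) auto
  also have "\<dots> = (\<Sum>j\<le>n. pade_coeff n (int l) (int k) j) * w ^ n" by (simp add: sum_distrib_right)
  also have "\<dots> \<le> (8 * int l) ^ n * fact n * w ^ n"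
    using w sum_pade_coeff_le[OF k n] by (intro mult_right_mono) auto
  finally show "pade_num n (int l) (int k) w \<le> (8 * int l) ^ n * fact n * w ^ n" .
  have "pade_den n (int l) (int k) w \<le> (\<Sum>j\<le>n. pade_coeff n (int l) (int k) (n - j) * w ^ n)"
    unfolding pade_den_def using w nn by (intro sum_mono mult_left_mono power_increasing) auto
  also have "\<dots> = (\<Sum>j\<le>n. pade_coeff n (int l) (int k) j * w ^ n)"
    by (rule sum.reindex_bij_witness[of _ "\<lambda>j. n - j" "\<lambda>j. n - j"]) auto
  also have "\<dots> = (\<Sum>j\<le>n. pade_coeff n (int l) (int k) j) * w ^ n" by (simp add: sum_distrib_right)
  also have "\<dots> \<le> (8 * int l) ^ n * fact n * w ^ n"
    using w sum_pade_coeff_le[OF k n] by (intro mult_right_mono) auto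
  finally show "pade_den n (int l) (int k) w \<le> (8 * int l) ^ n * fact n * w ^ n" .
qed

text \<open>The term of degree \<open>n\<close> alone suffices. In the denominator its factors
  \<open>l * (n - t) - k\<close> are at least half of \<open>l * (n - t)\<close>, since
  \<open>2 * k < l\<close>; this is the source of \<open>2 ^ n\<close>.\<close>

lemma pade_lower:
  assumes k: "0 < k" "2 * k < l" and w: "w \<ge> 1"
  shows "int l ^ n * fact n * w ^ n \<le> pade_num n (int l) (int k) w"
    and "int l ^ n * fact n * w ^ n \<le> 2 ^ n * pade_den n (int l) (int k) w"
proof -
  note nn = pade_coeff_nonneg[OF k]
  have fact: "(\<Prod>t<n. int l * (int n - int t)) = int l ^ n * fact n"
    using prod_consecutive[of n n] by (simp add: prod.distrib)
  have "int l ^ n * fact n \<le> pade_coeff n (int l) (int k) n"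
  proof -
    have "(\<Prod>t<n. int l * (int n - int t)) \<le> (\<Prod>t<n. int k + int l * int n - int l * int t)"
    proof (rule prod_mono)
      fix t assume "t \<in> {..<n}"
      hence "int l * int t \<le> int l * int n" by (intro mult_left_mono) auto
      moreover have "int l * (int n - int t) = int l * int n - int l * int t" by (simp add: algebra_simps)
      ultimately show "0 \<le> int l * (int n - int t) \<and> int l * (int n - int t) \<le> int k + int l * int n - int l * int t"
        by linarith
    qed
    thus ?thesis by (simp add: pade_coeff_def fact)
  qed
  hence "int l ^ n * fact n * w ^ n \<le> pade_coeff n (int l) (int k) n * w ^ n"
    using w by (intro mult_right_mono) auto
  also have "\<dots> \<le> pade_num n (int l) (int k) w"
    unfolding pade_num_def using nn w by (intro member_le_sum) auto
  finally show "int l ^ n * fact n * w ^ n \<le> pade_num n (int l) (int k) w" .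
  have "int l ^ n * fact n \<le> 2 ^ n * pade_coeff n (int l) (int k) 0"
  proof -
    have "(\<Prod>t<n. int l * (int n - int t)) \<le> (\<Prod>t<n. 2 * (int l * int n - int k - int l * int t))"
    proof (rule prod_mono)
      have int_k: "2 * int k < int l" using k by simp
      fix t assume "t \<in> {..<n}"
      hence "int l * (int t + 1) \<le> int l * int n" by (intro mult_left_mono) auto
      hence "int l * int t + int l \<le> int l * int n" by (simp add: algebra_simps)
      moreover have "int l * (int n - int t) = int l * int n - int l * int t" by (simp add: algebra_simps)
      ultimately show "0 \<le> int l * (int n - int t) \<and> int l * (int n - int t) \<le> 2 * (int l * int n - int k - int l * int t)"
        using int_k \<open>t \<in> {..<n}\<close> by auto
    qed
    also have "\<dots> = 2 ^ n * (\<Prod>t<n. int l * int n - int k - int l * int t)"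
      by (simp only: prod.distrib) simp
    finally show ?thesis by (simp add: pade_coeff_def fact)
  qed
  hence "int l ^ n * fact n * w ^ n \<le> 2 ^ n * pade_coeff n (int l) (int k) 0 * w ^ n"
    using w by (intro mult_right_mono) auto
  also have "pade_coeff n (int l) (int k) (n - n) * w ^ n \<le> pade_den n (int l) (int k) w"
    unfolding pade_den_def using nn w by (intro member_le_sum) auto
  hence "2 ^ n * pade_coeff n (int l) (int k) 0 * w ^ n \<le> 2 ^ n * pade_den n (int l) (int k) w"
    by (simp add: mult.assoc)
  finally show "int l ^ n * fact n * w ^ n \<le> 2 ^ n * pade_den n (int l) (int k) w" .
qed

text \<open>A nonzero multiple of \<open>u * p ^ b\<close> is at least that large. Cancelling
  \<open>u\<close> leaves only the \<open>l\<close>-part of \<open>fact n\<close> in the upper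
  bound, which turns \<open>8 * l\<close> into \<open>8 * l ^ 2\<close>.\<close>

lemma pade_bound:
  fixes p w \<alpha> \<beta> :: int and n l k a b :: nat
  assumes p: "prime p" and l: "prime l" and pl: "\<not> p dvd int l"
    and w: "p ^ a dvd w - 1" "a > 0" "w \<ge> 1" and ab: "b \<le> (2 * n + 1) * a" and n: "n \<ge> 1"
    and k: "0 < k" "2 * k < l"
    and eq: "[\<alpha> ^ l * w ^ k = \<beta> ^ l] (mod p ^ b)" "[\<alpha> = \<beta>] (mod p)" "\<not> p dvd \<beta>"
    and pos: "\<alpha> \<ge> 0" "\<beta> \<ge> 0"
    and ne: "\<alpha> * pade_num n (int l) (int k) w \<noteq> \<beta> * pade_den n (int l) (int k) w"
  shows "p ^ b \<le> max \<alpha> \<beta> * (8 * int l ^ 2 * w) ^ n"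
proof -
  obtain v u where vu: "fact n = l ^ v * u" "coprime u l" "v \<le> n" using fact_prime_part[OF l] by blast
  have u0: "int u > 0" using vu(1) by (metis fact_nonzero gr0I mult_zero_right of_nat_0_less_iff)
  have l1: "int l \<ge> 1" using k by simp
  define c where "c = (8 * int l) ^ n * fact n * w ^ n"
  define N where "N = pade_num n (int l) (int k) w"
  define D where "D = pade_den n (int l) (int k) w"
  have ND: "0 \<le> N" "N \<le> c" "0 \<le> D" "D \<le> c"
    using pade_upper[OF k n w(3)] w(3) unfolding N_def D_def c_def pade_num_def pade_den_def
    by (auto intro!: sum_nonneg mult_nonneg_nonneg pade_coeff_nonneg[OF k])
  have "int u * p ^ b dvd \<alpha> * N - \<beta> * D" unfolding N_def D_def
    by (rule pade_congruence[OF p l pl w(1,2) ab vu(1,2) eq])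
  hence "int u * p ^ b \<le> \<bar>\<alpha> * N - \<beta> * D\<bar>"
    using ne unfolding N_def D_def by (intro zdvd_imp_le) (auto simp: dvd_abs_iff)
  also have "\<dots> \<le> max \<alpha> \<beta> * c"
  proof -
    have "\<alpha> * N \<le> max \<alpha> \<beta> * c" "\<beta> * D \<le> max \<alpha> \<beta> * c"
      using ND pos by (auto intro!: mult_mono)
    moreover have "0 \<le> \<alpha> * N" "0 \<le> \<beta> * D" using ND pos by auto
    ultimately show ?thesis by linarith
  qed
  also have "c = (8 * int l) ^ n * (int l ^ v * int u) * w ^ n"
    unfolding c_def using vu(1) by (metis of_nat_fact of_nat_mult of_nat_power)
  also have "max \<alpha> \<beta> * \<dots> = int u * (max \<alpha> \<beta> * ((8 * int l) ^ n * int l ^ v * w ^ n))"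
    by (simp only: mult_ac)
  finally have "p ^ b \<le> max \<alpha> \<beta> * ((8 * int l) ^ n * int l ^ v * w ^ n)" using u0 by simp
  also have "\<dots> \<le> max \<alpha> \<beta> * ((8 * int l) ^ n * int l ^ n * w ^ n)"
    using pos w(3) l1 vu(3) by (intro mult_left_mono mult_right_mono power_increasing) auto
  also have "(8 * int l) ^ n * int l ^ n * w ^ n = (8 * int l ^ 2 * w) ^ n"
    by (simp only: power2_eq_square power_mult_distrib mult.assoc)
  finally show ?thesis .
qed

text \<open>Take \<open>w = x ^ l\<close>, with \<open>(\<alpha>, \<beta>)\<close> equal to
  \<open>(1, y * x ^ k)\<close> or \<open>(y, x ^ k)\<close>. The numerator is at most
  \<open>16 ^ n\<close> times the denominator, the denominator at most \<open>8 ^ n\<close> times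
  the numerator; the size hypotheses thus exclude that the linear form vanishes.\<close>

lemma pade_root_bound:
  fixes p l x y a b n k :: nat
  assumes p: "prime p" and l: "prime l" and pl: "[p = 1] (mod l)"
    and x: "x \<ge> 2" and y: "y \<ge> 2" and dvd: "p ^ a dvd repunit l x" "p ^ b dvd repunit l y"
    and ab: "0 < a" "b \<le> (2 * n + 1) * a" and n: "n \<ge> 1" and k: "0 < k" "2 * k < l"
  shows "[y * x ^ k = 1] (mod p ^ a) \<Longrightarrow> 16 ^ n < y * x ^ k \<Longrightarrow>
           real p ^ b \<le> real (y * x ^ k) * (8 * real l ^ 2 * real x ^ l) ^ n"
    and "[y = x ^ k] (mod p ^ a) \<Longrightarrow> 8 ^ n * x ^ k < y \<Longrightarrow>
           real p ^ b \<le> real y * (8 * real l ^ 2 * real x ^ l) ^ n"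
proof -
  define w where "w = int x ^ l"
  have ip: "prime (int p)" using p by simp
  have "p \<noteq> l"
    using pl l by (metis cong_0_iff cong_dvd_iff cong_sym dvd_refl nat_dvd_1_iff_1 not_prime_1)
  hence npl: "\<not> int p dvd int l" using p l primes_dvd_imp_eq by auto
  have w1: "w \<ge> 1" unfolding w_def using x by (intro one_le_power) auto
  have "[int (x ^ l) = int 1] (mod int (p ^ a))"
    unfolding cong_int_iff using cong_1_of_dvd_repunit[OF _ dvd(1)] x by simp
  hence xl: "[int x ^ l = 1] (mod int p ^ a)" by simp
  hence wd: "int p ^ a dvd w - 1" unfolding w_def by (simp add: cong_iff_dvd_diff)
  have "[int (y ^ l) = int 1] (mod int (p ^ b))"
    unfolding cong_int_iff using cong_1_of_dvd_repunit[OF _ dvd(2)] y by simp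
  hence yl: "[int y ^ l = 1] (mod int p ^ b)" by simp
  have pa: "int p dvd int p ^ a" using ab(1) by simp
  have l0: "l > 0" using k by simp
  have lw: "0 < int l ^ n * fact n * w ^ n" using l0 w1 by simp
  define N where "N = pade_num n (int l) (int k) w"
  define D where "D = pade_den n (int l) (int k) w"
  define B where "B = int l ^ n * fact n * w ^ n"
  have e8: "(8 * int l) ^ n * fact n * w ^ n = 8 ^ n * B"
    unfolding B_def by (simp add: power_mult_distrib)
  have NB: "N \<le> 8 ^ n * B" "D \<le> 8 ^ n * B" "B \<le> N" "B \<le> 2 ^ n * D"
    using pade_upper[OF k n w1] pade_lower[OF k w1, of n] unfolding N_def D_def e8 B_def by auto
  have B0: "B > 0" using lw by (simp add: B_def)
  have one: "[int x ^ l = 1] (mod int p)" using xl pa cong_dvd_modulus by blast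
  have nd1: "\<not> int p dvd 1" using ip by (metis not_prime_unit)
  have ndx: "\<not> int p dvd int x"
  proof
    assume "int p dvd int x"
    hence "int p dvd int x ^ l" by (rule dvd_trans) (use l0 in simp)
    thus False using one nd1 cong_dvd_iff by blast
  qed
  {
    assume c: "[y * x ^ k = 1] (mod p ^ a)" and big: "16 ^ n < y * x ^ k"
    define Y where "Y = int (y * x ^ k)"
    have "[int 1 = Y] (mod int (p ^ a))" unfolding Y_def cong_int_iff by (rule cong_sym[OF c])
    hence c': "[1 = Y] (mod int p ^ a)" by simp
    hence cp: "[1 = Y] (mod int p)" using pa cong_dvd_modulus by blast
    hence ndY: "\<not> int p dvd Y" using nd1 cong_dvd_iff by blast
    have "[Y ^ l = 1 * w ^ k] (mod int p ^ b)"
    proof -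
      have "Y ^ l = int y ^ l * w ^ k" unfolding Y_def w_def by (simp add: power_mult_distrib mult.commute flip: power_mult)
      thus ?thesis using cong_mult[OF yl cong_refl, of "w ^ k"] by simp
    qed
    hence eq: "[1 ^ l * w ^ k = Y ^ l] (mod int p ^ b)" by (simp add: cong_sym)
    have "2 ^ n * N \<le> 16 ^ n * B"
    proof -
      have "(2::int) ^ n * N \<le> 2 ^ n * (8 ^ n * B)" using NB(1) by (intro mult_left_mono) auto
      also have "\<dots> = 16 ^ n * B" by (simp add: mult.assoc[symmetric] power_mult_distrib[symmetric])
      finally show ?thesis .
    qed
    also have "\<dots> < Y * B" using B0 big unfolding Y_def by (intro mult_strict_right_mono) (simp_all add: of_nat_less_iff[symmetric, where 'a=int] del: of_nat_less_iff)
    also have "\<dots> \<le> Y * (2 ^ n * D)" using NB(4) by (intro mult_left_mono) (auto simp: Y_def)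
    finally have "2 ^ n * N < 2 ^ n * (Y * D)" by (simp add: mult_ac)
    hence ne: "1 * N \<noteq> Y * D" by auto
    have Y1: "Y \<ge> 1" using x y by (simp add: Y_def int_one_le_iff_zero_less)
    have "int p ^ b \<le> max 1 Y * (8 * int l ^ 2 * w) ^ n"
      by (rule pade_bound[OF ip l npl wd ab(1) w1 ab(2) n k eq cp ndY _ _ ne[unfolded N_def D_def]])
         (use Y1 in auto)
    also have "max 1 Y = Y" using Y1 by simp
    finally have "real_of_int (int p ^ b) \<le> real_of_int (Y * (8 * int l ^ 2 * w) ^ n)" by (simp only: of_int_le_iff)
    thus "real p ^ b \<le> real (y * x ^ k) * (8 * real l ^ 2 * real x ^ l) ^ n" by (simp add: Y_def w_def)
  }
  {
    assume c: "[y = x ^ k] (mod p ^ a)" and big: "8 ^ n * x ^ k < y"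
    define X where "X = int x ^ k"
    have "[int y = int (x ^ k)] (mod int (p ^ a))" unfolding cong_int_iff by (rule c)
    hence c': "[int y = X] (mod int p ^ a)" by (simp add: X_def)
    hence cp: "[int y = X] (mod int p)" using pa cong_dvd_modulus by blast
    have ndX: "\<not> int p dvd X" unfolding X_def using ndx ip prime_dvd_power by blast
    have "[int y ^ l * w ^ k = 1 * w ^ k] (mod int p ^ b)" by (intro cong_mult yl cong_refl)
    moreover have "w ^ k = X ^ l" unfolding X_def w_def by (simp add: mult.commute flip: power_mult)
    ultimately have eq: "[int y ^ l * w ^ k = X ^ l] (mod int p ^ b)" by simp
    have "int (8 ^ n * x ^ k) < int y" using big by (simp only: of_nat_less_iff)
    hence big': "8 ^ n * X < int y" by (simp add: X_def)
    have X1: "X \<ge> 1" unfolding X_def using x by (intro one_le_power) auto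
    have "X * D \<le> X * (8 ^ n * B)" using NB(2) X1 by (intro mult_left_mono) auto
    also have "\<dots> = (8 ^ n * X) * B" by simp
    also have "\<dots> < int y * B" using B0 big' by (intro mult_strict_right_mono) auto
    also have "\<dots> \<le> int y * N" using NB(3) by (intro mult_left_mono) auto
    finally have ne: "int y * N \<noteq> X * D" by simp
    have "X \<le> 8 ^ n * X" using X1 by simp
    with big' have "X \<le> int y" by linarith
    hence mx: "max (int y) X = int y" by simp
    have "int p ^ b \<le> max (int y) X * (8 * int l ^ 2 * w) ^ n"
      by (rule pade_bound[OF ip l npl wd ab(1) w1 ab(2) n k eq cp ndX _ _ ne[unfolded N_def D_def]])
         (use X1 in auto)
    hence "real_of_int (int p ^ b) \<le> real_of_int (int y * (8 * int l ^ 2 * w) ^ n)" unfolding mx by (simp only: of_int_le_iff)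
    thus "real p ^ b \<le> real y * (8 * real l ^ 2 * real x ^ l) ^ n" by (simp add: w_def)
  }
qed

subsection \<open>Logarithmic estimates\<close>

text \<open>The logarithm is bounded by its tangent at \<open>l = 19\<close>, where
  \<open>8 * l\<^sup>2 = 2888\<close> and \<open>2888\<^sup>2 \<le> 2 ^ 23\<close>. The factor 5.848
  is the gap between the first and the fourth solution.\<close>

lemma ln_8_square_le:
  fixes l :: real
  assumes "l \<ge> 19" and a: "5848 * ln 2 \<le> 1000 * a"
  shows "ln (8 * l\<^sup>2) \<le> 11/100 * ((l - 1) * a)"
proof -
  have l2: "ln 2 \<ge> (1/2 :: real)" using ln_le_minus_one[of "1/2 :: real"] by (simp add: ln_div)
  have "ln (2888 :: real) * 2 = ln (2888 ^ 2)" by (subst ln_realpow) auto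
  also have "\<dots> \<le> ln (2 ^ 23 :: real)" by (subst ln_le_cancel_iff) auto
  also have "\<dots> = 23 * ln 2" by (subst ln_realpow) auto
  finally have c: "2 * ln (2888 :: real) \<le> 23 * ln 2" by simp
  have "ln (8 * l\<^sup>2) = ln (2888 * (l / 19) ^ 2)" by (simp add: power2_eq_square)
  also have "\<dots> = ln 2888 + ln ((l / 19) ^ 2)" using assms by (subst ln_mult_pos) auto
  also have "ln ((l / 19) ^ 2) = 2 * ln (l / 19)" using assms by (subst ln_realpow) auto
  also have "ln (l / 19) \<le> l / 19 - 1" using assms by (intro ln_le_minus_one) auto
  finally have "ln (8 * l\<^sup>2) \<le> ln 2888 + 2 * (l / 19 - 1)" by simp
  moreover have "u \<le> 23/2 * t + 2/19 * (l - 19)" if "u \<le> s + 2 * (l / 19 - 1)" "2 * s \<le> 23 * t" for u s t :: real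
    using that by (simp add: field_simps)
  ultimately have "ln (8 * l\<^sup>2) \<le> 23/2 * ln 2 + 2/19 * (l - 19)" using c by blast
  also have "2/19 * (l - 19) \<le> 4/19 * (ln 2 * (l - 19))"
  proof -
    have "1/2 * (l - 19) \<le> ln 2 * (l - 19)" using l2 assms by (intro mult_right_mono) auto
    thus ?thesis by linarith
  qed
  also have "23/2 * ln 2 + 4/19 * (ln 2 * (l - 19)) \<le> 11/100 * (5848/1000) * (ln 2 * (l - 1))"
  proof -
    have "0 \<le> ln 2 * (l - 19)" using assms by simp
    moreover have "ln 2 * (l - 1) = ln 2 * (l - 19) + 18 * ln 2" by (simp add: algebra_simps)
    ultimately show ?thesis using l2 by linarith
  qed
  also have "5848/1000 * (ln 2 * (l - 1)) \<le> a * (l - 1)"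
    using mult_right_mono[of "5848/1000 * ln 2" a "l - 1"] a assms by simp
  hence "11/100 * (5848/1000) * (ln 2 * (l - 1)) \<le> 11/100 * ((l - 1) * a)" by (simp add: mult.commute)
  finally show ?thesis by simp
qed

text \<open>Since \<open>Q < 19/18 * (L * a1)\<close>, a gap reads
  \<open>18 * x - 19 * a1 \<le> 5 * y\<close>. From \<open>a2 > 1.8 * a1\<close> it yields the
  factors 2.68 and 5.848, and 0.1806 is \<open>19 / (18 * 5.848)\<close> rounded up.\<close>

lemma gap_estimates:
  fixes L a1 a2 a3 a4 Q :: real
  assumes L: "L \<ge> 18" and a1: "ln 2 \<le> a1" and Q: "Q < L * a1 + ln 2"
    and g: "9 * a1 < 5 * a2" "18 * (L * a2 - Q) < 5 * (L * a3)" "18 * (L * a3 - Q) < 5 * (L * a4)"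
  shows "5848 * a1 \<le> 1000 * a4" and "Q \<le> 1806/10000 * (L * a4)"
proof -
  have ln2: "ln 2 > (0::real)" by simp
  have a1_pos: "a1 > 0" using a1 ln2 by linarith
  have "18 * a1 \<le> L * a1" using L a1_pos by (intro mult_right_mono) auto
  hence Q': "Q < 19/18 * (L * a1)" using Q a1 by linarith
  have d: "18 * x - 19 * a1 \<le> 5 * y" if "18 * (L * x - Q) < 5 * (L * y)" for x y
  proof -
    have "L * (18 * x - 19 * a1) \<le> L * (5 * y)" using that Q' by (simp add: algebra_simps)
    thus ?thesis using L by simp
  qed
  show *: "5848 * a1 \<le> 1000 * a4" using d[OF g(2)] d[OF g(3)] g(1) by linarith
  have "L * (5848 * a1) \<le> L * (1000 * a4)" using * L by (intro mult_left_mono) auto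
  hence "5848 * (L * a1) \<le> 1000 * (L * a4)" by (simp only: mult.left_commute)
  moreover have "0 < L * a1" using L a1_pos by simp
  ultimately show "Q \<le> 1806/10000 * (L * a4)" using Q' by linarith
qed

text \<open>\<open>a\<close> and \<open>a'\<close> are the logarithms of the two largest solutions, \<open>P\<close> and \<open>P'\<close> those of the
  corresponding powers of \<open>p\<close>, \<open>Q\<close> is that of \<open>q\<close>, and \<open>n\<close> is the degree of the Pade approximation.\<close>
lemma pade_degree_estimate:
  fixes L a a' P P' Q n :: real
  assumes L: "L \<ge> 18" and a: "5848 * ln 2 \<le> 1000 * a" and Q: "0 \<le> Q" "Q \<le> 1806/10000 * (L * a)"
    and P: "L * a - Q < P" and P': "P' < L * a' + ln 2 - Q" and n: "(2 * n - 1) * P < P'" "n \<ge> 1"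
  shows "1638/1000 * (n * a) \<le> a' + 829/1000 * a"
proof -
  have ln2: "ln 2 > (0::real)" by simp
  have a0: "a > 0" using a ln2 by linarith
  \<comment> \<open>The share left by \<open>q\<close> is \<open>1 - 0.1806\<close>; the 0.0095
    below is \<open>1 / (18 * 5.848)\<close> rounded up.\<close>
  have "(2 * n - 1) * (8194/10000 * (L * a)) \<le> (2 * n - 1) * P"
    using P Q n by (intro mult_left_mono) auto
  also have "\<dots> \<le> L * a' + ln 2" using n(1) P' Q by linarith
  also have "ln 2 \<le> L * (95/10000 * a)"
  proof -
    have "18 * (95/10000 * a) \<le> L * (95/10000 * a)" using L a0 by (intro mult_right_mono) auto
    thus ?thesis using a ln2 by linarith
  qed
  finally have "L * ((2 * n - 1) * (8194/10000 * a)) \<le> L * (a' + 95/10000 * a)"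
    by (simp add: algebra_simps)
  hence "(2 * n - 1) * (8194/10000 * a) \<le> a' + 95/10000 * a" using L by simp
  hence "16388/10000 * (n * a) \<le> a' + 8289/10000 * a" by (simp add: algebra_simps)
  moreover have "0 \<le> n * a" using n a0 by simp
  ultimately show ?thesis using a0 by linarith
qed

text \<open>Here \<open>E\<close> is the logarithm of the extra factor \<open>x\<^sub>4 ^ k\<close>,
  or 0, and \<open>c\<close> that of \<open>8 * l\<^sup>2\<close>. The right side contains
  \<open>L * (n * a)\<close> with weight at most \<open>1 + 1/18 + 11/100\<close>; eliminating
  \<open>n\<close> would force \<open>a' < 5.5 * a\<close>.\<close>

lemma pade_contradiction:
  fixes L a a' P' Q n E c :: real
  assumes L: "L \<ge> 18" and a: "a > 0" and Q: "0 \<le> Q" "Q \<le> 1806/10000 * (L * a)"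
    and P': "L * a' - Q < P'" 
    and n: "1638/1000 * (n * a) \<le> a' + 829/1000 * a" "n \<ge> 1"
    and a': "574/100 * a \<le> a'"
    and E: "E \<le> 1/2 * (L * a)" and c: "c \<le> 11/100 * (L * a)"
    and up: "P' \<le> a' + E + n * (c + (L + 1) * a)"
  shows False
proof -
  have "n * c \<le> n * (11/100 * (L * a))" using c n by (intro mult_left_mono) auto
  moreover have "18 * (n * a) \<le> L * (n * a)" using L a n by (intro mult_right_mono) auto
  moreover have "L * (1638/1000 * (n * a)) \<le> L * (a' + 829/1000 * a)" using n L by (intro mult_left_mono) auto
  moreover have "L * (574/100 * a) \<le> L * a'" using a' L by (intro mult_left_mono) auto
  moreover have "18 * a' \<le> L * a'" using L a a' by (intro mult_right_mono) auto
  moreover have "0 < L * a" using L a by simp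
  moreover have "n * (c + (L + 1) * a) = n * c + L * (n * a) + n * a" by (simp add: algebra_simps)
  moreover have "n * (11/100 * (L * a)) = 11/100 * (L * (n * a))" by simp
  moreover have "L * (1638/1000 * (n * a)) = 1638/1000 * (L * (n * a))" by simp
  moreover have "L * (a' + 829/1000 * a) = L * a' + 829/1000 * (L * a)" by (simp add: algebra_simps)
  moreover have "L * (574/100 * a) = 574/100 * (L * a)" by simp
  ultimately show False using up P' E Q(2) by linarith
qed

section \<open>The contradiction from five solutions\<close>

lemma less_of_repunit_eq_prime_power:
  assumes "prime (p::nat)" "q > 0" "repunit l x = p ^ a * q" "repunit l y = p ^ b * q" "a < b"
  shows "x < y"
proof (rule ccontr)
  assume "\<not> x < y"
  hence "repunit l y \<le> repunit l x" by (intro repunit_mono) simp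
  moreover have "p ^ a < p ^ b" using assms prime_gt_1_nat by (intro power_strict_increasing) auto
  ultimately show False using assms by simp
qed

lemma solutions_multiplicatively_independent:
  assumes p: "prime p" "odd p" and l: "l \<ge> 4" and x: "x \<ge> 2" and y: "y \<ge> 2"
    and eq: "repunit l x = p ^ a * q" "repunit l y = p ^ b * q" and ab: "0 < a" "a < b"
    and AB: "A > 0" "B > 0"
  shows "x ^ A \<noteq> y ^ B"
proof
  assume e: "x ^ A = y ^ B"
  have r: "repunit l y = p ^ (b - a) * repunit l x"
    using ab unfolding eq by (simp flip: power_add mult.assoc)
  hence "repunit l x dvd repunit l y" by simp
  from repunit_dvd_multiplicatively_dependent[OF x y _ this e AB] l
  obtain r where "r \<ge> 1" "y = x ^ r" by auto
  moreover have "p dvd repunit l x" unfolding eq using ab by (simp add: dvd_power)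
  ultimately show False
    using repunit_power_ratio_not_prime_power[OF p l x, of r "b - a"] r ab by simp
qed

lemma ln_repunit:
  assumes "x \<ge> 2" "l \<ge> 2"
  shows "(real l - 1) * ln (real x) < ln (real (repunit l x))"
    and "ln (real (repunit l x)) < (real l - 1) * ln (real x) + ln 2"
proof -
  have x0: "real x > 0" using assms by simp
  have p: "ln (real x ^ (l - 1)) = (real l - 1) * ln (real x)"
    using assms by (simp add: ln_realpow of_nat_diff)
  have r0: "real (repunit l x) > 0" using repunit_pos[of l x] assms by simp
  have "real (x ^ (l - 1)) < real (repunit l x)" using repunit_gt[of x l] assms by (simp only: of_nat_less_iff)
  hence "ln (real x ^ (l - 1)) < ln (real (repunit l x))" using x0 r0 by (subst ln_less_cancel_iff) auto
  thus "(real l - 1) * ln (real x) < ln (real (repunit l x))" using p by simp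
  have "repunit l x < 2 * x ^ (l - 1)" using repunit_less[of x "l - 1"] assms by simp
  hence "real (repunit l x) < real (2 * x ^ (l - 1))" by (simp only: of_nat_less_iff)
  hence "ln (real (repunit l x)) < ln (2 * real x ^ (l - 1))" using x0 r0 by (subst ln_less_cancel_iff) auto
  also have "\<dots> = ln 2 + ln (real x ^ (l - 1))" using x0 by (subst ln_mult_pos) auto
  finally show "ln (real (repunit l x)) < (real l - 1) * ln (real x) + ln 2" using p by simp
qed

lemma ln_modulus_less:
  assumes r: "prime r" "prime l" "[r = 1] (mod l)" "l \<ge> 19" and e: "e \<ge> 1"
    and x: "x \<ge> 2" and xy: "x \<le> y"
    and dvd: "r ^ e dvd repunit l x" "r ^ e dvd repunit l y"
    and indep: "\<And>A B. A > 0 \<Longrightarrow> B > 0 \<Longrightarrow> x ^ A \<noteq> y ^ B"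
  shows "18 * (real e * ln (real r)) < 5 * ((real l - 1) * ln (real y))"
proof -
  obtain d where d: "2 * l < (d + 1) * (d + 2)" "18 * d \<le> 5 * (l - 1)"
    using exists_monomial_degree r(2,4) by blast
  have l3: "l \<ge> 3" using r(4) by simp
  have "r ^ e < y ^ d"
    by (rule modulus_less_power[OF r(1-3) l3 e x xy dvd _ d(1)]) (rule indep)
  hence "real (r ^ e) < real (y ^ d)" by (simp only: of_nat_less_iff)
  moreover have r0: "real r > 0" "real y > 0" using r x xy by (auto simp: prime_gt_0_nat)
  ultimately have "ln (real r ^ e) < ln (real y ^ d)" by (subst ln_less_cancel_iff) auto
  hence "real e * ln (real r) < real d * ln (real y)" using r0 by (simp add: ln_realpow)
  moreover have "real (18 * d) \<le> real (5 * (l - 1))" using d(2) by (simp only: of_nat_le_iff)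
  hence "18 * real d \<le> 5 * (real l - 1)" using r(4) by (simp add: of_nat_diff)
  hence "(18 * real d) * ln (real y) \<le> (5 * (real l - 1)) * ln (real y)"
    using x xy by (intro mult_right_mono) auto
  ultimately show ?thesis unfolding mult.assoc by linarith
qed

lemma five_solutions_nat:
  fixes l p q :: nat and x m :: "nat \<Rightarrow> nat"
  assumes l: "prime l" "l \<ge> 19" and p: "prime p" "[p = 1] (mod l)" and q: "prime q" "[q = 1] (mod l)"
    and sol: "\<And>i. i \<in> {1..5} \<Longrightarrow> x i \<ge> 2 \<and> repunit l (x i) = p ^ m i * q"
    and mono: "\<And>i j. i \<in> {1..5} \<Longrightarrow> j \<in> {1..5} \<Longrightarrow> i < j \<Longrightarrow> m i < m j"
  shows "m 1 = 0 \<and> (\<exists>r\<ge>1. x 2 = x 1 ^ r)"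
proof (rule ccontr)
  assume neg: "\<not> (m 1 = 0 \<and> (\<exists>r\<ge>1. x 2 = x 1 ^ r))"
  have x2: "x i \<ge> 2" and N: "repunit l (x i) = p ^ m i * q" if "i \<in> {1..5}" for i
    using sol[OF that] by auto
  have q0: "q > 0" using q prime_gt_0_nat by blast
  have p2: "p > 2"
  proof (rule ccontr)
    assume "\<not> p > 2"
    with p(1) have "p = 2" using prime_ge_2_nat[of p] by linarith
    with p(2) l show False by (simp add: cong_def)
  qed
  have p_odd: "odd p" using p(1) p2 prime_odd_nat by blast
  define L where "L = real l - 1"
  define a where "a i = ln (real (x i))" for i
  define t where "t = ln (real p)"
  define Q where "Q = ln (real q)"
  have L: "L \<ge> 18" unfolding L_def using l by simp
  have t0: "t > 0" unfolding t_def using p2 by (intro ln_gt_zero) simp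
  have Q0: "Q \<ge> 0" unfolding Q_def using q0 by (intro ln_ge_zero) simp
  have lnN: "L * a i < real (m i) * t + Q" "real (m i) * t + Q < L * a i + ln 2" if i: "i \<in> {1..5}" for i
  proof -
    have "ln (real (repunit l (x i))) = real (m i) * t + Q"
      unfolding N[OF i] t_def Q_def using p2 q0 by (simp add: ln_mult_pos ln_realpow)
    thus "L * a i < real (m i) * t + Q" "real (m i) * t + Q < L * a i + ln 2"
      using ln_repunit[OF x2[OF i], of l] l unfolding L_def a_def by auto
  qed
  have inc: "x i < x j" if "i \<in> {1..5}" "j \<in> {1..5}" "i < j" for i j
    by (rule less_of_repunit_eq_prime_power[OF p(1) q0 N[OF that(1)] N[OF that(2)] mono[OF that]])
  have aln2: "ln 2 \<le> a i" if "i \<in> {1..5}" for i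
    unfolding a_def using x2[OF that] by (subst ln_le_cancel_iff) auto
  have dvdN: "p ^ m i dvd repunit l (x i)" "p ^ m i dvd repunit l (x j)" "q dvd repunit l (x i)"
    if "i \<in> {1..5}" "j \<in> {1..5}" "i < j" for i j
  proof -
    have "p ^ m i dvd p ^ m j" using mono[OF that] by (intro le_imp_power_dvd) simp
    thus "p ^ m i dvd repunit l (x j)" using N[OF that(2)] by simp
  qed (use N[OF that(1)] in simp_all)
  \<comment> \<open>The larger of \<open>p ^ m 1\<close> and \<open>q\<close> carries at least half
    of the logarithm of the value, whence 9 in place of 18. The negated claim supplies independence
    even for \<open>m 1 = 0\<close>.\<close>
  have g1: "9 * a 1 < 5 * a 2"
  proof -
    have ind: "x 1 ^ A \<noteq> x 2 ^ B" if AB: "A > 0" "B > 0" for A B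
    proof
      assume e: "x 1 ^ A = x 2 ^ B"
      have "repunit l (x 1) dvd repunit l (x 2)"
        using N[of 1] N[of 2] mono[of 1 2] by (auto intro!: mult_dvd_mono le_imp_power_dvd)
      hence r: "\<exists>r\<ge>1. x 2 = x 1 ^ r"
        using repunit_dvd_multiplicatively_dependent[OF _ _ _ _ e AB, of l] x2[of 1] x2[of 2] l by auto
      with neg have "m 1 > 0" by auto
      thus False
        using solutions_multiplicatively_independent[OF p(1) p_odd _ x2 x2 N N _ mono AB, of 1 2] e l by auto
    qed
    have le: "x 1 \<le> x 2" using inc[of 1 2] by simp
    have "9 * (L * a 1) < 5 * (L * a 2)"
    proof (cases "q \<le> p ^ m 1")
      case True
      have "m 1 \<ge> 1"
      proof (rule ccontr)
        assume "\<not> m 1 \<ge> 1"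
        hence "m 1 = 0" by linarith
        with True have "q \<le> 1" by simp
        with prime_gt_1_nat[OF q(1)] show False by simp
      qed
      moreover have "p ^ m 1 dvd repunit l (x 1)" "p ^ m 1 dvd repunit l (x 2)" using dvdN[of 1 2] by auto
      ultimately have "18 * (real (m 1) * t) < 5 * (L * a 2)"
        using ln_modulus_less[OF p(1) l(1) p(2) l(2) _ x2 le _ _ ind, of "m 1"]
        unfolding t_def L_def a_def by auto
      moreover have "Q \<le> real (m 1) * t"
      proof -
        have "real q \<le> real (p ^ m 1)" using True by (simp only: of_nat_le_iff)
        hence "ln (real q) \<le> ln (real p ^ m 1)" using q0 p2 by (subst ln_le_cancel_iff) auto
        thus ?thesis unfolding Q_def t_def using p2 by (simp add: ln_realpow)
      qed
      ultimately show ?thesis using lnN(1)[of 1] by simp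
    next
      case False
      have "q ^ 1 dvd repunit l (x 1)" "q ^ 1 dvd repunit l (x 2)" using dvdN(3)[of 1 2] dvdN(3)[of 2 3] by auto
      hence "18 * (real 1 * Q) < 5 * (L * a 2)"
        using ln_modulus_less[OF q(1) l(1) q(2) l(2) _ x2 le _ _ ind, of 1]
        unfolding Q_def L_def a_def by auto
      moreover have "real (m 1) * t \<le> Q"
      proof -
        have "real (p ^ m 1) \<le> real q" using False by (simp only: of_nat_le_iff)
        hence "ln (real p ^ m 1) \<le> ln (real q)" using q0 p2 by (subst ln_le_cancel_iff) auto
        thus ?thesis unfolding Q_def t_def using p2 by (simp add: ln_realpow)
      qed
      ultimately show ?thesis using lnN(1)[of 1] by simp
    qed
    hence "L * (9 * a 1) < L * (5 * a 2)" by (simp add: mult.left_commute)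
    thus ?thesis using L by simp
  qed
  have ind: "x i ^ A \<noteq> x j ^ B" if "i \<in> {1..5}" "j \<in> {1..5}" "i < j" "m i > 0" "A > 0" "B > 0" for i j A B
    by (rule solutions_multiplicatively_independent[OF p(1) p_odd _ x2 x2 N N _ mono])
       (use that l in auto)
  have m0: "m i > 0" if "i \<in> {2..5}" for i using mono[of 1 i] that by auto
  have g: "18 * (L * a i - Q) < 5 * (L * a j)" if "i \<in> {2..5}" "j \<in> {1..5}" "i < j" for i j
  proof -
    have i: "i \<in> {1..5}" using that by auto
    have "18 * (real (m i) * t) < 5 * (L * a j)" unfolding t_def L_def a_def
    proof (rule ln_modulus_less[OF p(1) l(1) p(2) l(2) _ x2[OF i] _ dvdN(1,2)[OF i that(2,3)]])
      show "x i \<le> x j" using inc[OF i that(2,3)] by simp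
      show "1 \<le> m i" using m0[OF that(1)] by simp
      show "x i ^ A \<noteq> x j ^ B" if "A > 0" "B > 0" for A B
        using ind[OF i \<open>j \<in> {1..5}\<close> \<open>i < j\<close> m0[OF \<open>i \<in> {2..5}\<close>] that] .
    qed
    moreover have "18 * (u - Q) < c" if "18 * v < c" "u < v + Q" for u v c :: real
      using that by (simp add: algebra_simps)
    ultimately show ?thesis using lnN(1)[OF i] by blast
  qed
  \<comment> \<open>The value at the smallest solution bounds \<open>q\<close>.\<close>
  have "0 \<le> real (m 1) * t" using t0 by simp
  moreover have "real (m 1) * t + Q < L * a 1 + ln 2" by (rule lnN(2)) simp
  ultimately have Qa: "Q < L * a 1 + ln 2" by linarith
  note est = gap_estimates[OF L aln2 Qa g1 g[of 2 3] g[of 3 4]]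
  have a4: "5848 * a 1 \<le> 1000 * a 4" and Q4: "Q \<le> 1806/10000 * (L * a 4)" using est by auto
  have a4': "5848 * ln 2 \<le> 1000 * a 4" using a4 aln2[of 1] by simp
  have ln2: "ln 2 > (0::real)" by simp
  have a40: "a 4 > 0" using a4' ln2 by linarith
  define P where "P = real (m 4) * t"
  define P' where "P' = real (m 5) * t"
  have P: "L * a 4 - Q < P" using lnN(1)[of 4] unfolding P_def by simp
  have P': "L * a 5 - Q < P'" "P' < L * a 5 + ln 2 - Q" using lnN[of 5] unfolding P'_def by auto
  have m45: "m 4 < m 5" "m 4 > 0" using mono[of 4 5] m0[of 4] by auto
  obtain n where n: "n \<ge> 1" "m 5 \<le> (2 * n + 1) * m 4" "(2 * n - 1) * m 4 < m 5"
  proof -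
    \<comment> \<open>The least degree whose precision \<open>p ^ ((2 * n + 1) * m 4)\<close>
      reaches \<open>p ^ m 5\<close>. Minimality bounds \<open>n\<close> from above, and
      \<open>m 4 < m 5\<close> excludes \<open>n = 0\<close>.\<close>
    define n where "n = (LEAST n. m 5 \<le> (2 * n + 1) * m 4)"
    have "m 5 \<le> (2 * m 5 + 1) * m 4" using m45(2) by (cases "m 4") auto
    hence le: "m 5 \<le> (2 * n + 1) * m 4" unfolding n_def by (rule LeastI)
    have n1: "n \<ge> 1"
    proof (rule ccontr)
      assume "\<not> n \<ge> 1"
      hence "n = 0" by simp
      with le m45 show False by simp
    qed
    have "\<not> m 5 \<le> (2 * (n - 1) + 1) * m 4"
      using not_less_Least[of "n - 1" "\<lambda>n. m 5 \<le> (2 * n + 1) * m 4"] n1 unfolding n_def by auto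
    moreover have "2 * (n - 1) + 1 = 2 * n - 1" using n1 by simp
    ultimately have "(2 * n - 1) * m 4 < m 5" by (simp only: not_le)
    thus ?thesis by (rule that[OF n1 le])
  qed
  have nP: "(2 * real n - 1) * P < P'"
  proof -
    have "real ((2 * n - 1) * m 4) < real (m 5)" using n(3) by (simp only: of_nat_less_iff)
    hence "(2 * real n - 1) * real (m 4) < real (m 5)" using n(1) by (simp add: of_nat_diff)
    hence "(2 * real n - 1) * real (m 4) * t < real (m 5) * t" using t0 by (rule mult_strict_right_mono)
    thus ?thesis unfolding P_def P'_def by (simp add: mult.assoc)
  qed
  have H: "1638/1000 * (real n * a 4) \<le> a 5 + 829/1000 * a 4"
    using pade_degree_estimate[OF L a4' Q0 Q4 P P'(2) nP] n(1) by simp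
  define c where "c = ln (8 * (real l)\<^sup>2)"
  have c: "c \<le> 11/100 * (L * a 4)"
    using ln_8_square_le[OF _ a4', of "real l"] l unfolding c_def L_def by simp
  have lnb: "ln ((8 * real l ^ 2 * real (x 4) ^ l) ^ n) = real n * (c + (L + 1) * a 4)"
  proof -
    have "real (x 4) > 0" "real l > 0" using x2[of 4] l by auto
    thus ?thesis unfolding c_def L_def a_def by (simp add: ln_realpow ln_mult_pos)
  qed
  have four: "4 \<in> {1..5::nat}" "5 \<in> {1..5::nat}" "4 < (5::nat)" by auto
  obtain k where k: "k > 0" "2 * k < l" "[x 5 = x 4 ^ k] (mod p ^ m 4) \<or> [x 5 * x 4 ^ k = 1] (mod p ^ m 4)"
    using small_signed_exponent[OF p(1) l(1) p(2) _ _ x2[OF four(1)] x2[OF four(2)] dvdN(1,2)[OF four]] l m45 by auto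
  have ka: "real k * a 4 \<le> 1/2 * (L * a 4)"
  proof -
    have "2 * real k \<le> L" using k(2) unfolding L_def by linarith
    hence "(2 * real k) * a 4 \<le> L * a 4" using a40 by (intro mult_right_mono) auto
    thus ?thesis by simp
  qed
  have PL: "8194/10000 * (L * a 4) < P" using P Q4 by linarith
  have La: "18 * a 4 \<le> L * a 4" using L a40 by (intro mult_right_mono) auto
  have pos: "real (x 4) > 0" "real (x 5) > 0" "real p > 0" using x2[of 4] x2[of 5] p2 by auto
  have lnp: "ln (real p ^ m 4) = P" "ln (real p ^ m 5) = P'" unfolding P_def P'_def t_def using pos by (simp_all add: ln_realpow)
  have nln2: "5848 * (real n * ln 2) \<le> 1000 * (real n * a 4)"
    using mult_left_mono[OF a4', of "real n"] by (simp add: algebra_simps)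
  have b0: "8 * real l ^ 2 * real (x 4) ^ l > 0" using pos l by simp
  note bound = pade_root_bound[OF p(1) l(1) p(2) x2[OF four(1)] x2[OF four(2)] dvdN(1)[OF four] _
    m45(2) n(2,1) k(1,2)]
  have d5: "p ^ m 5 dvd repunit l (x 5)" using N[of 5] by simp
  from k(3) show False
  proof
    assume cong: "[x 5 * x 4 ^ k = 1] (mod p ^ m 4)"
    have lnY: "ln (real (x 5 * x 4 ^ k)) = a 5 + real k * a 4"
      unfolding a_def using pos by (simp add: ln_mult_pos ln_realpow)
    have "x 4 ^ k \<ge> 1" using x2[of 4] by (intro one_le_power) simp
    hence "2 * 1 \<le> x 5 * x 4 ^ k" using x2[of 5] by (intro mult_le_mono) simp_all
    hence gt: "1 < x 5 * x 4 ^ k" by linarith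
    hence "p ^ m 4 dvd x 5 * x 4 ^ k - 1"
      using cong cong_altdef_nat[OF less_imp_le[OF gt]] by blast
    hence "p ^ m 4 \<le> x 5 * x 4 ^ k - 1" by (rule dvd_imp_le) (use gt in linarith)
    hence "p ^ m 4 \<le> x 5 * x 4 ^ k" by linarith
    hence "real (p ^ m 4) \<le> real (x 5 * x 4 ^ k)" by (simp only: of_nat_le_iff)
    hence "ln (real p ^ m 4) \<le> ln (real (x 5 * x 4 ^ k))" using pos by (subst ln_le_cancel_iff) auto
    hence a5: "P \<le> a 5 + real k * a 4" using lnY lnp by simp
    \<comment> \<open>\<open>(0.8194 - 0.5) * 18 > 5.74\<close>: the modulus minus the largest
      possible \<open>x\<^sub>4 ^ k\<close>, on the logarithmic scale.\<close>
    hence a5': "574/100 * a 4 \<le> a 5" using PL ka La a40 by linarith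
    have "ln (real (16 ^ n)) = 4 * (real n * ln 2)"
    proof -
      have "real (16 ^ n) = 2 ^ (4 * n)" by (simp add: power_mult)
      thus ?thesis by (simp add: ln_realpow)
    qed
    also have "\<dots> < a 5" using nln2 H a5' a40 by linarith
    also have "\<dots> \<le> ln (real (x 5 * x 4 ^ k))" using lnY a40 by simp
    finally have "real (16 ^ n) < real (x 5 * x 4 ^ k)" using pos by (subst (asm) ln_less_cancel_iff) auto
    hence "16 ^ n < x 5 * x 4 ^ k" by (simp only: of_nat_less_iff)
    hence "real p ^ m 5 \<le> real (x 5 * x 4 ^ k) * (8 * real l ^ 2 * real (x 4) ^ l) ^ n"
      using bound(1)[OF d5 cong] by blast
    hence "ln (real p ^ m 5) \<le> ln (real (x 5 * x 4 ^ k) * (8 * real l ^ 2 * real (x 4) ^ l) ^ n)"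
      using pos b0 by (subst ln_le_cancel_iff) auto
    also have "\<dots> = ln (real (x 5 * x 4 ^ k)) + ln ((8 * real l ^ 2 * real (x 4) ^ l) ^ n)"
      using pos b0 by (intro ln_mult_pos) auto
    finally have "P' \<le> a 5 + real k * a 4 + real n * (c + (L + 1) * a 4)" unfolding lnp lnY lnb .
    thus False using pade_contradiction[OF L a40 Q0 Q4 P'(1) H _ a5' ka c] n(1) by simp
  next
    assume cong: "[x 5 = x 4 ^ k] (mod p ^ m 4)"
    have lnX: "ln (real (x 4 ^ k)) = real k * a 4" unfolding a_def using pos by (simp add: ln_realpow)
    have ne: "x 4 ^ k \<noteq> x 5" using ind[OF four m45(2) k(1), of 1] by simp
    have big: "P \<le> ln (real z)" if "[y = z] (mod p ^ m 4)" "y < z" for y z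
    proof -
      have "p ^ m 4 dvd z - y" using that by (metis cong_altdef_nat cong_sym less_imp_le)
      hence "p ^ m 4 \<le> z" using that by (meson diff_le_self dvd_imp_le le_trans zero_less_diff)
      hence "real (p ^ m 4) \<le> real z" by (simp only: of_nat_le_iff)
      hence "ln (real p ^ m 4) \<le> ln (real z)" using pos that(2) by (subst ln_le_cancel_iff) auto
      thus ?thesis using lnp by simp
    qed
    \<comment> \<open>Two distinct congruent numbers cannot both lie below the modulus, and
      \<open>x\<^sub>4 ^ k\<close> does; so \<open>x\<^sub>5\<close> exceeds it and even reaches the
      modulus.\<close>
    have "\<not> x 5 < x 4 ^ k"
    proof
      assume "x 5 < x 4 ^ k"
      from big[OF cong this] have "P \<le> real k * a 4" using lnX by simp
      thus False using PL ka a40 La by linarith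
    qed
    hence "x 4 ^ k < x 5" using ne by simp
    hence a5: "P \<le> a 5" using big[OF cong_sym[OF cong]] unfolding a_def by simp
    hence a5': "574/100 * a 4 \<le> a 5" using PL La a40 by linarith
    have "ln (real (8 ^ n * x 4 ^ k)) = 3 * (real n * ln 2) + real k * a 4"
    proof -
      have "(8::real) ^ n = 2 ^ (3 * n)" by (simp add: power_mult)
      hence "ln ((8::real) ^ n) = 3 * (real n * ln 2)" by (simp add: ln_realpow)
      moreover have "ln (real (8 ^ n * x 4 ^ k)) = ln ((8::real) ^ n) + ln (real (x 4 ^ k))"
        using pos by (simp add: ln_mult_pos)
      ultimately show ?thesis using lnX by simp
    qed
    also have "\<dots> < ln (real (x 5))" using nln2 H a5 PL ka La a40 unfolding a_def[symmetric] by linarith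
    finally have "real (8 ^ n * x 4 ^ k) < real (x 5)" using pos by (subst (asm) ln_less_cancel_iff) auto
    hence "8 ^ n * x 4 ^ k < x 5" by (simp only: of_nat_less_iff)
    hence "real p ^ m 5 \<le> real (x 5) * (8 * real l ^ 2 * real (x 4) ^ l) ^ n"
      using bound(2)[OF d5 cong] by blast
    hence "ln (real p ^ m 5) \<le> ln (real (x 5) * (8 * real l ^ 2 * real (x 4) ^ l) ^ n)"
      using pos b0 by (subst ln_le_cancel_iff) auto
    also have "\<dots> = ln (real (x 5)) + ln ((8 * real l ^ 2 * real (x 4) ^ l) ^ n)"
      using pos b0 by (intro ln_mult_pos) auto
    finally have "P' \<le> a 5 + 0 + real n * (c + (L + 1) * a 4)" unfolding lnp lnb a_def[symmetric] by simp
    moreover have "0 \<le> 1/2 * (L * a 4)" using L a40 by simp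
    ultimately show False using pade_contradiction[OF L a40 Q0 Q4 P'(1) H _ a5' _ c, of 0] n(1) by simp
  qed
qed

subsection \<open>At most four solutions\<close>

lemma is_solution_iff_repunit:
  assumes "l > 0"
  shows "is_solution l p q x m \<longleftrightarrow> x > 1 \<and> repunit l (nat x) = p ^ m * q"
proof (cases "x > 1")
  case True
  then obtain y where y: "x = int y" "y > 1" by (cases x) auto
  have "(rat_of_int x ^ l - 1) / (rat_of_int x - 1) = (\<Sum>i<l. rat_of_nat y ^ i)"
    using y by (simp add: geometric_sum)
  also have "\<dots> = rat_of_nat (repunit l y)" by (simp add: repunit_def)
  finally have "(rat_of_int x ^ l - 1) / (rat_of_int x - 1) = rat_of_nat p ^ m * rat_of_nat q \<longleftrightarrow>
      rat_of_nat (repunit l y) = rat_of_nat (p ^ m * q)" by simp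
  thus ?thesis using y unfolding is_solution_def of_nat_eq_iff by simp
qed (simp add: is_solution_def)

lemma repunit_strict_mono:
  assumes "x < y" "l \<ge> 2"
  shows "repunit l x < repunit l y"
  unfolding repunit_def
proof (rule sum_strict_mono_ex1)
  show "\<forall>i\<in>{..<l}. x ^ i \<le> y ^ i" using assms by (auto intro: power_mono)
  show "\<exists>i\<in>{..<l}. x ^ i < y ^ i" using assms by (intro bexI[of _ 1]) auto
qed simp

lemma five_solutions:
  fixes l p q :: nat and x :: "nat \<Rightarrow> int" and m :: "nat \<Rightarrow> nat"
  assumes "prime l" "l \<ge> 19" "prime p" "[p = 1] (mod l)" "prime q" "[q = 1] (mod l)"
    and sol: "\<forall>i\<in>{1..5}. is_solution l p q (x i) (m i)" and mono: "strict_mono_on {1..5} m"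
  shows "m 1 = 0 \<and> (\<exists>r\<ge>1. x 2 = x 1 ^ r)"
proof -
  have sol': "x i > 1 \<and> repunit l (nat (x i)) = p ^ m i * q" if "i \<in> {1..5}" for i
    using sol that is_solution_iff_repunit[of l p q "x i" "m i"] \<open>l \<ge> 19\<close> by simp
  have "m 1 = 0 \<and> (\<exists>r\<ge>1. nat (x 2) = nat (x 1) ^ r)"
  proof (rule five_solutions_nat[OF assms(1-6)])
    show "2 \<le> nat (x i) \<and> repunit l (nat (x i)) = p ^ m i * q" if "i \<in> {1..5}" for i
      using sol'[OF that] by auto
    show "m i < m j" if "i \<in> {1..5}" "j \<in> {1..5}" "i < j" for i j
      using mono that by (rule strict_mono_onD)
  qed
  then obtain r where r: "m 1 = 0" "r \<ge> 1" "nat (x 2) = nat (x 1) ^ r" by blast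
  have "x 1 > 1" "x 2 > 1" using sol'[of 1] sol'[of 2] by auto
  hence "x 2 = int (nat (x 2))" "x 1 = int (nat (x 1))" by simp_all
  hence "x 2 = x 1 ^ r" using r(3) by (metis of_nat_power)
  thus ?thesis using r by blast
qed

theorem theorem1:
  fixes l p q :: nat
  assumes "prime l" and "prime p" and "prime q"
    and "l \<ge> 19"
    and "[p = 1] (mod l)" and "[q = 1] (mod l)"
  shows "finite {(x, m). is_solution l p q x m \<and> m > 0} \<and>
    card {(x, m). is_solution l p q x m \<and> m > 0} \<le> 4 \<and>
    (\<forall>(x :: nat \<Rightarrow> int) (m :: nat \<Rightarrow> nat).
      (\<forall>i\<in>{1..5}. is_solution l p q (x i) (m i)) \<and> strict_mono_on {1..5} m \<longrightarrow>
      m 1 = 0 \<and> (\<exists>r::nat. r \<ge> 1 \<and> x 2 = x 1 ^ r))"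
proof -
  note five = five_solutions[OF assms(1,4,2,5,3,6)]
  define S where "S = {(x, m). is_solution l p q x m \<and> m > 0}"
  \<comment> \<open>Repunits increase strictly with the base, so a solution is determined by its
    exponent and solutions may be counted by \<open>m\<close>.\<close>
  have inj: "inj_on snd S"
  proof (rule inj_onI)
    fix s t assume st: "s \<in> S" "t \<in> S" "snd s = snd t"
    obtain x y m where xy: "s = (x, m)" "t = (y, m)" using st(3) by (cases s, cases t) auto
    have *: "x > 1" "y > 1" "repunit l (nat x) = repunit l (nat y)"
      using st xy is_solution_iff_repunit[of l p q] assms(4) unfolding S_def by auto
    have "nat x = nat y"
    proof (rule ccontr)
      assume "nat x \<noteq> nat y"
      hence "nat x < nat y \<or> nat y < nat x" by linarith
      thus False
        using repunit_strict_mono[of "nat x" "nat y" l] repunit_strict_mono[of "nat y" "nat x" l] *(3) assms(4)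
        by auto
    qed
    with * xy show "s = t" by simp
  qed
  have no_five: False if T: "T \<subseteq> S" "finite T" "card T = 5" for T
  proof -
    define ms where "ms = sorted_list_of_set (snd ` T)"
    have inj': "inj_on snd T" using inj T(1) inj_on_subset by blast
    have len: "length ms = 5" unfolding ms_def using T inj' by (simp add: card_image)
    have set: "set ms = snd ` T" unfolding ms_def using T by simp
    \<comment> \<open>The sorted exponents, shifted from list positions to \<open>1..5\<close>; the
      smallest one would have to be 0, although all are positive.\<close>
    define m where "m i = ms ! (i - 1)" for i
    have sol: "\<exists>x. is_solution l p q x (m i) \<and> m i > 0" if "i \<in> {1..5}" for i
    proof -
      have "m i \<in> set ms" unfolding m_def using that len by (intro nth_mem) auto
      thus ?thesis using T(1) unfolding set S_def by auto
    qed
    then obtain x where x: "\<And>i. i \<in> {1..5} \<Longrightarrow> is_solution l p q (x i) (m i)" by metis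
    have "strict_mono_on {1..5} m"
    proof (rule strict_mono_onI)
      fix i j :: nat assume ij: "i \<in> {1..5}" "j \<in> {1..5}" "i < j"
      have "sorted_wrt (<) ms" unfolding ms_def by (rule strict_sorted_list_of_set)
      from sorted_wrt_nth_less[OF this, of "i - 1" "j - 1"] show "m i < m j"
        unfolding m_def using ij len by auto
    qed
    hence "m 1 = 0" using five[of x m] x by blast
    with sol[of 1] show False by auto
  qed
  have fin: "finite S"
  proof (rule ccontr)
    assume "infinite S"
    then obtain T where "T \<subseteq> S" "finite T" "card T = 5"
      using infinite_arbitrarily_large[of S 5] by blast
    thus False using no_five by blast
  qed
  have "card S \<le> 4"
  proof (rule ccontr)
    assume "\<not> card S \<le> 4"
    then obtain T where "T \<subseteq> S" "card T = 5" "finite T"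
      using obtain_subset_with_card_n[of 5 S] by force
    thus False using no_five by blast
  qed
  with fin show ?thesis using five unfolding S_def by blast
qed

end
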